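(* Let $d$ be a positive integer and $G$ a graph. If $G$ is $d(d+1)^2$-connected, or $\mathcal{R}_d(G)$ is vertically $(d(d+1))^2$-connected, then $G$ is $\mathcal{R}_d$-reconstructible.
   Context: Graphs are finite, simple, without isolated vertices. For a graph $G$ and $p:V(G)\to\mathbb{R}^d$, the rigidity matrix $R(G,p)$ has a row for each edge and $d$ columns per vertex; the row of $uv$ has $p(u)-p(v)$ in the columns of $u$, $p(v)-p(u)$ in the columns of $v$, and zeros elsewhere. $\mathcal{R}_d(G)$ is the row matroid of $R(G,p)$ for a generic $p$. For a matroid with rank function $r$ on ground set $E$ and a positive integer $k$, a bipartition $(E_1,E_2)$ of $E$ is a vertical $k$-separation if $r(E_1),r(E_2)\ge k$ and $r(E_1)+r(E_2)\le r(E)+k-1$; the matroid is vertically $k$-connected if its rank is at least $k$ and it has no vertical $k'$-separation for any positive integer $k'<k$. $G$ is $\mathcal{R}_d$-reconstructible if for every graph $H$ and every matroid isomorphism $\psi:E(G)\to E(H)$ between $\mathcal{R}_d(G)$ and $\mathcal{R}_d(H)$ there is a graph isomorphism $\varphi:V(G)\to V(H)$ with $\psi(uv)=\varphi(u)\varphi(v)$ for all $uv\in E(G)$. *)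

theory Defs
  imports Complex_Main "HOL-Library.Poly_Mapping"
begin

text \<open>A (finite, simple) graph without isolated vertices is represented by its edge set:
  a finite set of 2-element sets of vertices. Its vertex set is the union of its edges.\<close>

definition is_graph :: "'a set set \<Rightarrow> bool" where
  "is_graph E \<longleftrightarrow> finite E \<and> (\<forall>e\<in>E. card e = 2)"

definition verts :: "'a set set \<Rightarrow> 'a set" where
  "verts E = \<Union>E"

text \<open>Graph k-connectivity: more than k vertices, and deleting any set of fewer than k
  vertices leaves a connected graph.\<close>

definition connected_avoiding :: "'a set set \<Rightarrow> 'a set \<Rightarrow> bool" where
  "connected_avoiding E X \<longleftrightarrow>
     (\<forall>u\<in>verts E - X. \<forall>v\<in>verts E - X.
        (u, v) \<in> {(x, y). {x, y} \<in> E \<and> x \<notin> X \<and> y \<notin> X}\<^sup>*)"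

definition k_connected :: "nat \<Rightarrow> 'a set set \<Rightarrow> bool" where
  "k_connected k E \<longleftrightarrow> card (verts E) > k \<and>
     (\<forall>X. X \<subseteq> verts E \<and> card X < k \<longrightarrow> connected_avoiding E X)"

text \<open>Multivariate polynomials over the reals (as finitely supported maps from monomials
  to coefficients) and their evaluation.\<close>

definition mpoly_eval :: "(('v \<Rightarrow>\<^sub>0 nat) \<Rightarrow>\<^sub>0 real) \<Rightarrow> ('v \<Rightarrow> real) \<Rightarrow> real" where
  "mpoly_eval P f = (\<Sum>mon\<in>Poly_Mapping.keys P. Poly_Mapping.lookup P mon * (\<Prod>x\<in>Poly_Mapping.keys (mon :: 'v \<Rightarrow>\<^sub>0 nat). f x ^ Poly_Mapping.lookup mon x))"

text \<open>The family (f x) for x in I is algebraically independent over the rationals.\<close>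

definition alg_indep_Q :: "'v set \<Rightarrow> ('v \<Rightarrow> real) \<Rightarrow> bool" where
  "alg_indep_Q I f \<longleftrightarrow>
     (\<forall>P. (\<forall>m. Poly_Mapping.lookup P m \<in> \<rat>) \<and> (\<forall>m\<in>Poly_Mapping.keys P. Poly_Mapping.keys m \<subseteq> I) \<and> mpoly_eval P f = 0
          \<longrightarrow> P = 0)"

text \<open>A configuration p : V \<rightarrow> R^d (coordinates indexed by 0..<d) is generic if its
  coordinates on V are algebraically independent over Q.\<close>

definition generic :: "nat \<Rightarrow> 'a set \<Rightarrow> ('a \<Rightarrow> nat \<Rightarrow> real) \<Rightarrow> bool" where
  "generic d V p \<longleftrightarrow> alg_indep_Q (V \<times> {0..<d}) (\<lambda>(v, i). p v i)"

text \<open>Row of the rigidity matrix for edge e = {u,v}: p(u)-p(v) in the columns of u,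
  p(v)-p(u) in the columns of v, zero elsewhere. Columns are indexed by (vertex, coordinate).\<close>

definition rig_row :: "nat \<Rightarrow> ('a \<Rightarrow> nat \<Rightarrow> real) \<Rightarrow> 'a set \<Rightarrow> ('a \<times> nat) \<Rightarrow> real" where
  "rig_row d p e = (\<lambda>(w, i). if w \<in> e \<and> i < d then (\<Sum>x\<in>e. p w i - p x i) else 0)"

definition rows_lin_indep :: "nat \<Rightarrow> ('a \<Rightarrow> nat \<Rightarrow> real) \<Rightarrow> 'a set set \<Rightarrow> bool" where
  "rows_lin_indep d p F \<longleftrightarrow>
     (\<forall>c. (\<forall>col. (\<Sum>e\<in>F. c e * rig_row d p e col) = 0) \<longrightarrow> (\<forall>e\<in>F. c e = 0))"

text \<open>Independent sets of the generic d-dimensional rigidity matroid R_d(G): row sets of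
  R(G,p) that are linearly independent for a generic p.\<close>

definition rig_indep :: "nat \<Rightarrow> 'a set set \<Rightarrow> 'a set set \<Rightarrow> bool" where
  "rig_indep d E F \<longleftrightarrow> F \<subseteq> E \<and>
     (\<exists>p. generic d (verts E) p \<and> rows_lin_indep d p F)"

definition rig_rank :: "nat \<Rightarrow> 'a set set \<Rightarrow> 'a set set \<Rightarrow> nat" where
  "rig_rank d E F = Max {card I | I. I \<subseteq> F \<and> rig_indep d E I}"

definition vertical_sep :: "nat \<Rightarrow> 'a set set \<Rightarrow> nat \<Rightarrow> 'a set set \<Rightarrow> 'a set set \<Rightarrow> bool" where
  "vertical_sep d E k E1 E2 \<longleftrightarrow>
     E1 \<union> E2 = E \<and> E1 \<inter> E2 = {} \<and>
     rig_rank d E E1 \<ge> k \<and> rig_rank d E E2 \<ge> k \<and>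
     rig_rank d E E1 + rig_rank d E E2 \<le> rig_rank d E E + k - 1"

definition vert_k_connected :: "nat \<Rightarrow> 'a set set \<Rightarrow> nat \<Rightarrow> bool" where
  "vert_k_connected d E k \<longleftrightarrow> rig_rank d E E \<ge> k \<and>
     (\<forall>k'. 0 < k' \<and> k' < k \<longrightarrow> \<not> (\<exists>E1 E2. vertical_sep d E k' E1 E2))"

definition rig_matroid_iso :: "nat \<Rightarrow> 'a set set \<Rightarrow> 'b set set \<Rightarrow> ('a set \<Rightarrow> 'b set) \<Rightarrow> bool" where
  "rig_matroid_iso d E H \<psi> \<longleftrightarrow> bij_betw \<psi> E H \<and>
     (\<forall>F. F \<subseteq> E \<longrightarrow> (rig_indep d E F \<longleftrightarrow> rig_indep d H (\<psi> ` F)))"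

text \<open>R_d-reconstructibility, for target graphs H with vertices of type 'b.\<close>

definition rd_reconstructible :: "nat \<Rightarrow> 'a set set \<Rightarrow> 'b itself \<Rightarrow> bool" where
  "rd_reconstructible d E T \<longleftrightarrow>
     (\<forall>(H :: 'b set set) \<psi>. is_graph H \<and> rig_matroid_iso d E H \<psi> \<longrightarrow>
        (\<exists>\<phi>. bij_betw \<phi> (verts E) (verts H) \<and> (\<forall>e\<in>E. \<psi> e = \<phi> ` e)))"

end

theory Submission
  imports Defs "HOL-Analysis.Continuum_Not_Denumerable"
begin

text \<open>
  A \<open>d (d + 1)\<close>-connected graph is rigid (Villanyi). Otherwise its closure in the rigidity matroid
  is not complete, and after deleting the simplicial vertices every vertex still has at least
  \<open>d (d + 1)\<close> neighbours, which do not form a clique. Adding the vertices one by one in random order,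
  the rank grows by \<open>min t d\<close> at a vertex with \<open>t\<close> earlier neighbours (0-extension), and by \<open>d + 1\<close>
  if \<open>t > d\<close> and these are not a clique (1-extension). The expected growth is at least \<open>d\<close> per vertex,
  which exceeds the rank of the complete graph.

  Consequently, for a \<open>d (d + 1)\<^sup>2\<close>-connected graph \<open>G\<close> the matroids of \<open>G\<close> and of all \<open>G - v\<close> have
  high vertical connectivity: removing one after the other vertices that meet both sides of a
  bipartition of the edges, each removal gains one unit of rank, and deleting few vertices keeps the
  graph rigid. Conversely, a small vertex separator yields a vertical separation of low order, so
  the images of \<open>G\<close> and \<open>G - v\<close> under a matroid isomorphism are \<open>d (d + 1)\<close>-connected, hence rigid, and
  counting ranks shows that the edges of \<open>G - v\<close> are mapped onto those of \<open>H - w\<close> for a vertex \<open>w\<close>.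
\<close>

section \<open>Matroid rank\<close>

text \<open>The constant \<open>d * (d + 1)^2\<close> splits as \<open>d * (d + 1) + K\<close> with
  \<open>K = d * (d * (d + 1))\<close>. Vertical \<open>K\<close>-connectivity forces
  \<open>d * (d + 1)\<close>-connectivity, because a separator of fewer than \<open>c\<close>
  vertices spans rank at most \<open>d * (c - 2)\<close>. The other summand keeps the graph rigid
  during the at most \<open>K - 1\<close> vertex removals; the removal that is saved pays for
  passing from \<open>G\<close> to \<open>G - v\<close>. Likewise \<open>(d * (d + 1))^2\<close> is
  \<open>d\<close> times \<open>d * (d + 1)^2\<close>, which reduces the vertical hypothesis to the
  graph-theoretic one. The number \<open>d * (d + 1)\<close> itself is the break-even point of the
  averaging: with \<open>k\<close> neighbours the expected growth is at least
  \<open>d + (k - d * (d + 1)) / (2 * k)\<close>. Simplicial vertices have to go because a clique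
  neighbourhood offers no pair for a 1-extension. All combinatorics takes place in an abstract
  matroid on the edges over a whole vertex type, so subgraphs share one rank function; genericity
  matters only for showing that the generic rigidity matroid is an instance.\<close>

locale finitary_matroid =
  fixes indep :: "'e set \<Rightarrow> bool"
  assumes indep_finite: "indep I \<Longrightarrow> finite I"
    and indep_empty: "indep {}"
    and indep_subset: "indep I \<Longrightarrow> J \<subseteq> I \<Longrightarrow> indep J"
    and augment: "indep I \<Longrightarrow> indep J \<Longrightarrow> card I < card J \<Longrightarrow> \<exists>e\<in>J - I. indep (insert e I)"
begin

definition rk :: "'e set \<Rightarrow> nat" where
  "rk F = Max {card I | I. I \<subseteq> F \<and> indep I}"

lemma
  assumes "finite F"
  shows rk_ge: "I \<subseteq> F \<Longrightarrow> indep I \<Longrightarrow> card I \<le> rk F"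
    and rk_attained: "\<exists>I\<subseteq>F. indep I \<and> card I = rk F"
proof -
  let ?S = "{card I | I. I \<subseteq> F \<and> indep I}"
  have fin: "finite ?S" using assms by auto
  have "?S \<noteq> {}" using indep_empty by blast
  then have "Max ?S \<in> ?S" using fin by (rule Max_in[rotated])
  then show "\<exists>I\<subseteq>F. indep I \<and> card I = rk F" unfolding rk_def by auto
  show "card I \<le> rk F" if "I \<subseteq> F" "indep I"
    unfolding rk_def using that fin by (intro Max_ge) auto
qed

lemma basis_extend:
  assumes "finite F" "I \<subseteq> F" "indep I"
  obtains B where "I \<subseteq> B" "B \<subseteq> F" "indep B" "card B = rk F"
proof -
  let ?P = "\<lambda>B. I \<subseteq> B \<and> B \<subseteq> F \<and> indep B"
  have "\<exists>B. ?P B \<and> (\<forall>C. ?P C \<longrightarrow> card C \<le> card B)"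
    using assms by (intro ex_has_greatest_nat[of ?P I card "Suc (card F)"])
      (auto simp: less_Suc_eq_le intro: card_mono)
  then obtain B where B: "?P B" and max: "\<And>C. ?P C \<Longrightarrow> card C \<le> card B" by blast
  have "card B = rk F"
  proof (rule ccontr)
    assume "card B \<noteq> rk F"
    then have less: "card B < rk F" using rk_ge[OF assms(1)] B by (meson le_neq_implies_less)
    obtain J where J: "J \<subseteq> F" "indep J" "card J = rk F" using rk_attained[OF assms(1)] by blast
    then obtain e where e: "e \<in> J - B" "indep (insert e B)" using augment B less by metis
    then have "card (insert e B) \<le> card B" using B J by (intro max) auto
    then show False using e B indep_finite by simp
  qed
  then show ?thesis using that B by blast
qed

lemma rk_le_card: "finite F \<Longrightarrow> rk F \<le> card F"
  by (metis card_mono rk_attained)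

lemma rk_indep: "indep I \<Longrightarrow> rk I = card I"
  by (meson indep_finite order_antisym order_refl rk_ge rk_le_card)

lemma rk_empty [simp]: "rk {} = 0"
  using rk_le_card[of "{}"] by simp

lemma rk_mono: "finite B \<Longrightarrow> A \<subseteq> B \<Longrightarrow> rk A \<le> rk B"
  by (metis finite_subset rk_attained rk_ge subset_trans)

text \<open>A basis of \<open>A \<inter> B\<close> is extended to one of \<open>A\<close> and then
  to one of \<open>A \<union> B\<close>. The last basis meets \<open>A\<close> and \<open>B\<close>
  in independent sets whose intersection contains the first.\<close>

lemma rk_submodular:
  assumes "finite A" "finite B"
  shows "rk (A \<union> B) + rk (A \<inter> B) \<le> rk A + rk B"
proof -
  obtain I where I: "I \<subseteq> A \<inter> B" "indep I" "card I = rk (A \<inter> B)"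
    using rk_attained assms by (metis finite_Int)
  obtain J where J: "I \<subseteq> J" "J \<subseteq> A" "indep J" "card J = rk A"
    using basis_extend[of A I] I assms by auto
  obtain L where L: "J \<subseteq> L" "L \<subseteq> A \<union> B" "indep L" "card L = rk (A \<union> B)"
    using basis_extend[of "A \<union> B" J] J assms by auto
  have fin: "finite L" using L indep_finite by blast
  have "card (L \<inter> A) \<le> rk A" "card (L \<inter> B) \<le> rk B"
    using assms L indep_subset by (auto intro!: rk_ge)
  moreover have "card I \<le> card (L \<inter> A \<inter> (L \<inter> B))"
    using I J L fin by (intro card_mono) auto
  moreover have "card (L \<inter> A) + card (L \<inter> B) = card L + card (L \<inter> A \<inter> (L \<inter> B))"
    using card_Un_Int[of "L \<inter> A" "L \<inter> B"] fin L by (metis Int_Un_distrib finite_Int inf.absorb1)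
  ultimately show ?thesis using I L by linarith
qed

lemma rk_Un_le: "finite A \<Longrightarrow> finite B \<Longrightarrow> rk (A \<union> B) \<le> rk A + rk B"
  using rk_submodular[of A B] by linarith

lemma spanned_mono:
  assumes "finite B" "A \<subseteq> B" "rk (insert e A) = rk A"
  shows "rk (insert e B) = rk B"
proof -
  have fin: "finite A" using assms finite_subset by blast
  have "rk (insert e A \<union> B) + rk (insert e A \<inter> B) \<le> rk (insert e A) + rk B"
    using assms fin by (intro rk_submodular) auto
  moreover have "rk A \<le> rk (insert e A \<inter> B)" using assms fin by (intro rk_mono) auto
  moreover have "insert e A \<union> B = insert e B" using assms by auto
  moreover have "rk B \<le> rk (insert e B)" using assms by (intro rk_mono) auto
  ultimately show ?thesis using assms by simp
qed

lemma rk_Un_spanned: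
  assumes "finite A" "finite X" "\<And>e. e \<in> X \<Longrightarrow> rk (insert e A) = rk A"
  shows "rk (A \<union> X) = rk A"
  using assms(2,3)
proof (induction X rule: finite_induct)
  case (insert e X)
  have "rk (insert e (A \<union> X)) = rk (A \<union> X)"
    using insert.hyps(1) assms(1) spanned_mono[of "A \<union> X" A e] insert.prems[of e] by simp
  moreover have "rk (A \<union> X) = rk A" using insert.prems by (intro insert.IH) auto
  ultimately show ?case by simp
qed simp

lemma indep_insert_unspanned:
  assumes "finite F" "indep B" "B \<subseteq> F" "card B = rk F" "rk (insert e F) \<noteq> rk F"
  shows "indep (insert e B)"
proof -
  obtain B' where B': "B \<subseteq> B'" "B' \<subseteq> insert e F" "indep B'" "card B' = rk (insert e F)"
    using basis_extend[of "insert e F" B] assms by auto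
  have "e \<in> B'"
  proof (rule ccontr)
    assume "e \<notin> B'"
    then have "card B' \<le> rk F" using B' assms by (intro rk_ge) auto
    moreover have "rk F \<le> rk (insert e F)" using assms by (intro rk_mono) auto
    ultimately show False using B' assms by simp
  qed
  then show ?thesis using B' indep_subset by blast
qed

lemma rk_insert_dependent:
  assumes "indep B" "\<not> indep (insert e B)"
  shows "rk (insert e B) = rk B"
proof (rule ccontr)
  assume "rk (insert e B) \<noteq> rk B"
  then have "indep (insert e B)"
    using assms indep_finite rk_indep by (intro indep_insert_unspanned[of B]) auto
  then show False using assms by simp
qed

end

section \<open>Matroids with the extension properties of generic rigidity\<close>

definition all_edges :: "'a set \<Rightarrow> 'a set set" where
  "all_edges W = {e. e \<subseteq> W \<and> card e = 2}"

definition star :: "'a \<Rightarrow> 'a set \<Rightarrow> 'a set set" where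
  "star v N = (\<lambda>u. {v, u}) ` N"

lemma all_edges_mono: "V \<subseteq> W \<Longrightarrow> all_edges V \<subseteq> all_edges W"
  by (auto simp: all_edges_def)

lemma finite_all_edges [simp]: "finite W \<Longrightarrow> finite (all_edges W)"
  by (simp add: all_edges_def)

lemma pair_in_all_edges [simp]: "{x, y} \<in> all_edges W \<longleftrightarrow> x \<noteq> y \<and> x \<in> W \<and> y \<in> W"
  by (auto simp: all_edges_def)

lemma all_edges_cases:
  assumes "e \<in> all_edges W"
  obtains x y where "e = {x, y}" "x \<noteq> y" "x \<in> W" "y \<in> W"
  using assms by (auto simp: all_edges_def card_2_iff)

lemma all_edges_empty [simp]: "all_edges {} = {}"
  by (auto simp: all_edges_def)

lemma all_edges_insert:
  "v \<notin> W \<Longrightarrow> all_edges (insert v W) = all_edges W \<union> star v W"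
  by (auto simp: star_def elim!: all_edges_cases)

lemma is_graph_all_edges: "is_graph G \<longleftrightarrow> finite G \<and> G \<subseteq> all_edges (verts G)"
  by (auto simp: is_graph_def all_edges_def verts_def)

lemma finite_verts: "is_graph G \<Longrightarrow> finite (verts G)"
  unfolding is_graph_def verts_def by (metis card.infinite finite_Union zero_neq_numeral)

lemma verts_subset: "G \<subseteq> all_edges W \<Longrightarrow> verts G \<subseteq> W"
  by (auto simp: verts_def all_edges_def)

lemma finite_star [simp]: "finite N \<Longrightarrow> finite (star v N)"
  by (simp add: star_def)

lemma card_star: "card (star v N) = card N"
  unfolding star_def by (rule card_image) (auto simp: inj_on_def doubleton_eq_iff)

lemma verts_star_subset: "verts (star v N) \<subseteq> insert v N"
  by (auto simp: verts_def star_def)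

text \<open>The rank of the complete graph on \<open>n\<close> vertices, built vertex by vertex; it
  equals the familiar \<open>d * n - d * (d + 1) / 2\<close> once \<open>n \<ge> d\<close>. The sum
  form avoids a case distinction for small \<open>n\<close>.\<close>

definition rho :: "nat \<Rightarrow> nat \<Rightarrow> nat" where
  "rho d n = (\<Sum>j<n. min j d)"

lemma rho_Suc: "rho d (Suc n) = rho d n + min n d"
  by (simp add: rho_def)

lemma rho_0 [simp]: "rho d 0 = 0"
  by (simp add: rho_def)

text \<open>Lets the rank of a rigid graph determine its number of vertices. Counts start at 1
  because \<open>rho d 0 = rho d 1\<close>.\<close>

lemma rho_strict_mono:
  assumes "d \<ge> 1" "1 \<le> m" "m < n"
  shows "rho d m < rho d n"
  using assms(3)
proof (induction n)
  case (Suc n)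
  then show ?case using assms by (cases "m = n") (auto simp: rho_Suc)
qed simp

lemma rho_le: "rho d n \<le> d * (n - 1)"
proof (induction n)
  case (Suc n)
  then show ?case by (cases n) (auto simp: rho_Suc min_def algebra_simps)
qed simp

lemma rho_ge: "d \<ge> 1 \<Longrightarrow> n - 1 \<le> rho d n"
proof (induction n)
  case (Suc n)
  then show ?case by (cases n) (auto simp: rho_Suc min_def)
qed simp

text \<open>These three properties are all that the combinatorial part knows about rigidity. The
  last one, together with 0-extensions, makes the complete graph on \<open>d + 2\<close> vertices a
  circuit.\<close>

locale rigidity_matroid = finitary_matroid indep for indep :: "'a set set \<Rightarrow> bool" +
  fixes d :: nat
  assumes d_pos: "d \<ge> 1"
    and zero_extension:
      "indep F \<Longrightarrow> v \<notin> verts F \<Longrightarrow> finite N \<Longrightarrow> v \<notin> N \<Longrightarrow> card N \<le> d \<Longrightarrow> indep (F \<union> star v N)"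
    and one_extension:
      "indep (insert {x, y} F) \<Longrightarrow> {x, y} \<notin> F \<Longrightarrow> v \<notin> verts (insert {x, y} F) \<Longrightarrow>
       x \<in> N \<Longrightarrow> y \<in> N \<Longrightarrow> v \<notin> N \<Longrightarrow> card N = d + 1 \<Longrightarrow> indep (F \<union> star v N)"
    and clique_dependent: "card W = d + 2 \<Longrightarrow> \<not> indep (all_edges W)"
begin

lemma rk_add_star:
  assumes "finite F" "v \<notin> verts F" "finite N" "v \<notin> N"
  shows "rk F + min (card N) d \<le> rk (F \<union> star v N)"
proof -
  obtain B where B: "B \<subseteq> F" "indep B" "card B = rk F" using rk_attained[OF assms(1)] by blast
  obtain M where M: "M \<subseteq> N" "card M = min (card N) d"
    by (meson min.cobounded1 obtain_subset_with_card_n)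
  have finM: "finite M" using M assms finite_subset by blast
  have "indep (B \<union> star v M)"
    using B M assms finM by (intro zero_extension) (auto simp: verts_def)
  moreover have "B \<union> star v M \<subseteq> F \<union> star v N" using B M by (auto simp: star_def)
  ultimately have "card (B \<union> star v M) \<le> rk (F \<union> star v N)" using assms by (intro rk_ge) auto
  moreover have "B \<inter> star v M = {}" using B assms by (auto simp: star_def verts_def)
  then have "card (B \<union> star v M) = rk F + min (card N) d"
    using B M finM assms by (subst card_Un_disjoint) (auto simp: card_star intro: finite_subset)
  ultimately show ?thesis by simp
qed

text \<open>The star grows leaf by leaf: each new leaf is a 0-extension whose only neighbour is the
  centre, which is allowed as \<open>d \<ge> 1\<close>.\<close>

lemma indep_star: "finite N \<Longrightarrow> v \<notin> N \<Longrightarrow> indep (star v N)"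
proof (induction N rule: finite_induct)
  case empty
  then show ?case using indep_empty by (simp add: star_def)
next
  case (insert u N)
  have "indep (star v N \<union> star u {v})"
    using insert verts_star_subset[of v N] d_pos by (intro zero_extension) auto
  moreover have "star v N \<union> star u {v} = star v (insert u N)" by (auto simp: star_def)
  ultimately show ?case by simp
qed

lemma rk_star: "finite N \<Longrightarrow> v \<notin> N \<Longrightarrow> rk (star v N) = card N"
  using indep_star rk_indep card_star by metis

lemma indep_small_clique:
  assumes "finite W" "card W \<le> d + 1"
  shows "indep (all_edges W)"
  using assms
proof (induction W rule: finite_induct)
  case empty
  show ?case using indep_empty by simp
next
  case (insert v W)
  have "indep (all_edges W \<union> star v W)"
    using insert verts_subset[of "all_edges W" W] by (intro zero_extension) auto
  then show ?case using insert by (simp add: all_edges_insert)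
qed

text \<open>The complete graph on \<open>D \<union> {a, b}\<close> is a circuit when \<open>D\<close> has \<open>d\<close> vertices.\<close>

lemma missing_edge_spanned:
  assumes "finite F" "card D = d" "a \<notin> D" "b \<notin> D" "a \<noteq> b"
    and "all_edges (insert a D) \<subseteq> F" "all_edges (insert b D) \<subseteq> F"
  shows "rk (insert {a, b} F) = rk F"
proof -
  have finD: "finite D" using assms d_pos card.infinite by force
  let ?K = "all_edges (insert a D) \<union> star b D"
  have ind: "indep ?K"
    using assms finD verts_subset[of "all_edges (insert a D)" "insert a D"]
    by (intro zero_extension indep_small_clique) auto
  have eq: "insert {a, b} ?K = all_edges (insert b (insert a D))"
    using assms by (subst (2) all_edges_insert) (auto simp: star_def insert_commute)
  have "\<not> indep (insert {a, b} ?K)"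
    unfolding eq using assms finD by (intro clique_dependent) auto
  then have "rk (insert {a, b} ?K) = rk ?K" using ind rk_insert_dependent by blast
  moreover have "?K \<subseteq> F" using assms by (auto simp: all_edges_insert)
  ultimately show ?thesis using assms(1) spanned_mono by blast
qed

text \<open>A new vertex \<open>v\<close> raises the rank by at least \<open>min (card W) d\<close>
  by 0-extension. It gains no more: once \<open>v\<close> is joined to \<open>d\<close> vertices
  \<open>D\<close>, every further edge \<open>vu\<close> completes the circuit on
  \<open>D \<union> {v, u}\<close>.\<close>

lemma rk_all_edges: "finite W \<Longrightarrow> rk (all_edges W) = rho d (card W)"
proof (induction W rule: finite_induct)
  case empty
  show ?case by simp
next
  case (insert v W)
  have vW: "v \<notin> verts (all_edges W)" using insert verts_subset[of "all_edges W" W] by auto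
  have "rk (all_edges W \<union> star v W) \<le> rk (all_edges W) + min (card W) d"
  proof -
    obtain D where D: "D \<subseteq> W" "card D = min (card W) d"
      by (meson min.cobounded1 obtain_subset_with_card_n)
    have finD: "finite D" using D insert finite_subset by blast
    let ?F = "all_edges W \<union> star v D"
    have "rk (insert {v, u} ?F) = rk ?F" if u: "u \<in> W" for u
    proof (cases "u \<in> D")
      case True
      then have "{v, u} \<in> ?F" by (auto simp: star_def)
      then show ?thesis by (simp add: insert_absorb)
    next
      case False
      then have "D \<noteq> W" using u by auto
      then have "card D < card W" using D insert psubset_card_mono by blast
      then have "card D = d" using D by auto
      moreover have "all_edges (insert v D) \<subseteq> ?F"
        using D insert all_edges_mono[of D W] by (subst all_edges_insert) auto
      moreover have "all_edges (insert u D) \<subseteq> ?F"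
        using D u all_edges_mono[of "insert u D" W] by auto
      ultimately show ?thesis
        using False u D insert finD by (intro missing_edge_spanned[where D = D]) auto
    qed
    then have "rk (?F \<union> star v W) = rk ?F"
      using insert finD by (intro rk_Un_spanned) (auto simp: star_def)
    moreover have "?F \<union> star v W = all_edges W \<union> star v W" using D by (auto simp: star_def)
    moreover have "rk ?F \<le> rk (all_edges W) + rk (star v D)"
      using insert finD by (intro rk_Un_le) auto
    moreover have "rk (star v D) \<le> min (card W) d"
      using rk_le_card finD D by (metis card_star finite_star)
    ultimately show ?thesis by (metis add_left_mono le_trans)
  qed
  moreover have "rk (all_edges W) + min (card W) d \<le> rk (all_edges W \<union> star v W)"
    using insert vW by (intro rk_add_star) auto
  ultimately show ?case using insert by (simp add: all_edges_insert rho_Suc)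
qed

lemma rk_le_rho: "finite W \<Longrightarrow> F \<subseteq> all_edges W \<Longrightarrow> rk F \<le> rho d (card W)"
  by (metis finite_all_edges rk_all_edges rk_mono)

text \<open>The vertices of \<open>U\<close> are added one by one to the clique on \<open>W\<close>.
  Each is joined to all of \<open>S\<close> and to the earlier ones, so the 0-extension bound equals
  the growth of \<open>rho d (card (S \<union> U))\<close>.\<close>

lemma rk_union_cliques_ge:
  assumes "finite S" "finite W" "finite U" "S \<subseteq> W" "U \<inter> W = {}"
  shows "rho d (card W) + rho d (card (S \<union> U))
    \<le> rk (all_edges W \<union> all_edges (S \<union> U)) + rho d (card S)"
  using assms(3,5)
proof (induction U rule: finite_induct)
  case empty
  have "all_edges W \<union> all_edges S = all_edges W" using assms all_edges_mono by blast
  then show ?case using assms rk_all_edges by simp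
next
  case (insert v U)
  let ?F = "all_edges W \<union> all_edges (S \<union> U)"
  have "v \<notin> S \<union> U" using insert assms by auto
  then have *: "all_edges (S \<union> insert v U) = all_edges (S \<union> U) \<union> star v (S \<union> U)"
    using all_edges_insert[of v "S \<union> U"] by simp
  have "verts ?F \<subseteq> W \<union> U"
    using verts_subset[of ?F "W \<union> U"] all_edges_mono[of W "W \<union> U"] all_edges_mono[of "S \<union> U" "W \<union> U"] assms
    by blast
  then have "rk ?F + min (card (S \<union> U)) d \<le> rk (?F \<union> star v (S \<union> U))"
    using insert assms \<open>v \<notin> S \<union> U\<close> by (intro rk_add_star) auto
  then show ?case
    using insert assms \<open>v \<notin> S \<union> U\<close> * by (auto simp: rho_Suc Un_assoc)
qed

text \<open>For complete sides this is the rank of two cliques glued along \<open>S\<close>. By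
  submodularity, shrinking one side and then the other does not increase the defect
  \<open>rk E1 + rk E2 - rk (E1 \<union> E2)\<close>.\<close>

lemma rk_separation:
  assumes "finite S" "finite A" "finite B" "A \<inter> B = {}" "A \<inter> S = {}" "B \<inter> S = {}"
    and E1: "E1 \<subseteq> all_edges (A \<union> S)" and E2: "E2 \<subseteq> all_edges (S \<union> B)"
  shows "rk E1 + rk E2 \<le> rk (E1 \<union> E2) + rho d (card S)"
proof -
  let ?K1 = "all_edges (A \<union> S)" and ?K2 = "all_edges (S \<union> B)"
  have fin: "finite ?K1" "finite ?K2" "finite E1" "finite E2"
    using assms finite_subset[OF E1] finite_subset[OF E2] by auto
  have "rho d (card (A \<union> S)) + rho d (card (S \<union> B)) \<le> rk (?K1 \<union> ?K2) + rho d (card S)"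
    using assms by (intro rk_union_cliques_ge) auto
  then have "rk ?K1 + rk ?K2 \<le> rk (?K1 \<union> ?K2) + rho d (card S)"
    using rk_all_edges assms by simp
  moreover have "rk (?K1 \<union> ?K2) + rk E1 \<le> rk (E1 \<union> ?K2) + rk ?K1"
  proof -
    have "rk ((E1 \<union> ?K2) \<union> ?K1) + rk ((E1 \<union> ?K2) \<inter> ?K1) \<le> rk (E1 \<union> ?K2) + rk ?K1"
      using fin by (intro rk_submodular) auto
    moreover have "rk E1 \<le> rk ((E1 \<union> ?K2) \<inter> ?K1)" using fin E1 by (intro rk_mono) auto
    moreover have "(E1 \<union> ?K2) \<union> ?K1 = ?K1 \<union> ?K2" using E1 by auto
    ultimately show ?thesis by simp
  qed
  moreover have "rk (E1 \<union> ?K2) + rk E2 \<le> rk (E1 \<union> E2) + rk ?K2"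
  proof -
    have "rk ((E1 \<union> E2) \<union> ?K2) + rk ((E1 \<union> E2) \<inter> ?K2) \<le> rk (E1 \<union> E2) + rk ?K2"
      using fin by (intro rk_submodular) auto
    moreover have "rk E2 \<le> rk ((E1 \<union> E2) \<inter> ?K2)" using fin E2 by (intro rk_mono) auto
    moreover have "(E1 \<union> E2) \<union> ?K2 = E1 \<union> ?K2" using E2 by auto
    ultimately show ?thesis by simp
  qed
  ultimately show ?thesis by linarith
qed

end

section \<open>Averaging over vertex orders\<close>

text \<open>In a uniformly random order of \<open>m + 1\<close> elements, the probability that the
  predecessors of a fixed element form a given \<open>s\<close>-set. Note that \<open>m\<close>
  counts the other elements only.\<close>

definition shapley :: "nat \<Rightarrow> nat \<Rightarrow> real" where
  "shapley m s = fact s * fact (m - s) / fact (Suc m)"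

text \<open>One additional element comes either after or before the fixed one; the two events
  partition the old one.\<close>

lemma shapley_split:
  assumes "s \<le> m"
  shows "shapley (Suc m) s + shapley (Suc m) (Suc s) = shapley m s"
proof -
  let ?X = "fact s * fact (m - s) :: real" and ?Y = "fact (Suc (Suc m)) :: real"
  have "shapley (Suc m) s = ?X * real (Suc (m - s)) / ?Y"
    using assms by (simp add: shapley_def Suc_diff_le del: of_nat_Suc)
  moreover have "shapley (Suc m) (Suc s) = ?X * real (Suc s) / ?Y"
    by (simp add: shapley_def del: of_nat_Suc)
  ultimately have "shapley (Suc m) s + shapley (Suc m) (Suc s)
    = ?X * (real (Suc (m - s)) + real (Suc s)) / ?Y"
    by (simp only: distrib_left add_divide_distrib)
  also have "real (Suc (m - s)) + real (Suc s) = real (Suc (Suc m))" using assms by simp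
  also have "?Y = real (Suc (Suc m)) * fact (Suc m)" by (rule fact_Suc)
  finally show ?thesis by (simp add: shapley_def del: fact_Suc of_nat_Suc)
qed

text \<open>The position of a fixed element in a random order is uniform.\<close>

lemma shapley_binomial:
  assumes "s \<le> m"
  shows "shapley m s * real (m choose s) = 1 / real (Suc m)"
proof -
  have "shapley m s * real (m choose s) = (fact s * fact (m - s) * real (m choose s)) / fact (Suc m)"
    by (simp add: shapley_def)
  also have "fact s * fact (m - s) * real (m choose s) = fact m"
    using binomial_fact_lemma[OF assms] by (metis of_nat_fact of_nat_mult)
  finally show ?thesis by simp
qed

lemma sum_Pow_insert:
  assumes "finite U" "w \<notin> U"
  shows "(\<Sum>S\<in>Pow (insert w U). g S) = (\<Sum>S\<in>Pow U. g S + g (insert w S) :: real)"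
proof -
  have "(\<Sum>S\<in>Pow (insert w U). g S) = (\<Sum>S\<in>Pow U. g S) + (\<Sum>S\<in>insert w ` Pow U. g S)"
    unfolding Pow_insert using assms by (intro sum.union_disjoint) auto
  also have "(\<Sum>S\<in>insert w ` Pow U. g S) = (\<Sum>S\<in>Pow U. g (insert w S))"
    using assms by (subst sum.reindex) (auto simp: inj_on_def insert_ident)
  finally show ?thesis by (simp add: sum.distrib)
qed

text \<open>Elements outside \<open>N\<close> do not influence the random order induced on
  \<open>N\<close> and the fixed element. They are inserted one at a time by
  \<open>shapley_split\<close>.\<close>

lemma shapley_marginal:
  assumes "finite U" "N \<subseteq> U"
  shows "(\<Sum>S\<in>Pow U. shapley (card U) (card S) * h (S \<inter> N))
    = (\<Sum>T\<in>Pow N. shapley (card N) (card T) * h T)"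
proof -
  have *: "(\<Sum>S\<in>Pow (N \<union> W). shapley (card (N \<union> W)) (card S) * h (S \<inter> N))
    = (\<Sum>T\<in>Pow N. shapley (card N) (card T) * h T)" if "finite W" "W \<inter> N = {}" for W
    using that
  proof (induction W rule: finite_induct)
    case empty
    have "S \<inter> N = S" if "S \<in> Pow N" for S using that by auto
    then show ?case by simp
  next
    case (insert w W)
    let ?U = "N \<union> W"
    have U: "finite ?U" "w \<notin> ?U" using insert assms finite_subset by auto
    have "(\<Sum>S\<in>Pow (insert w ?U). shapley (card (insert w ?U)) (card S) * h (S \<inter> N))
      = (\<Sum>S\<in>Pow ?U. shapley (card ?U) (card S) * h (S \<inter> N))"
      unfolding sum_Pow_insert[OF U]
    proof (rule sum.cong[OF refl])
      fix S assume S: "S \<in> Pow ?U"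
      then have "finite S" "w \<notin> S" "card S \<le> card ?U" "insert w S \<inter> N = S \<inter> N"
        using U insert finite_subset[of S ?U] card_mono[of ?U S] by auto
      then show "shapley (card (insert w ?U)) (card S) * h (S \<inter> N)
          + shapley (card (insert w ?U)) (card (insert w S)) * h (insert w S \<inter> N)
        = shapley (card ?U) (card S) * h (S \<inter> N)"
        using U shapley_split[of "card S" "card ?U"] by (simp flip: distrib_right)
    qed
    then show ?case using insert by simp
  qed
  have "N \<union> (U - N) = U" using assms by auto
  then show ?thesis using *[of "U - N"] assms by auto
qed

text \<open>Along every single order the increments telescope. The proof compares, for each
  \<open>A\<close>, the coefficients of \<open>f A\<close> in the positive and the negative sum;
  they cancel unless \<open>A\<close> is empty or all of \<open>V\<close>.\<close>

lemma shapley_efficiency: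
  assumes "finite V"
  shows "(\<Sum>v\<in>V. \<Sum>S\<in>Pow (V - {v}). shapley (card (V - {v})) (card S) * (f (insert v S) - f S))
    = f V - f {}"
proof (cases "V = {}")
  case False
  let ?n = "card V"
  have n: "?n > 0" using False assms by auto
  let ?w = "shapley (?n - 1)"
  \<comment> \<open>The probability that \<open>A\<close> is an initial segment of the random
    order.\<close>
  define u where "u A = (fact (card A) * fact (?n - card A) / fact ?n :: real)" for A :: "'a set"
  have cardm: "card (V - {v}) = ?n - 1" if "v \<in> V" for v using that assms by simp
  have "(\<Sum>v\<in>V. \<Sum>S\<in>Pow (V - {v}). ?w (card S) * f (insert v S))
    = (\<Sum>v\<in>V. \<Sum>A\<in>{A\<in>Pow V. v \<in> A}. ?w (card A - 1) * f A)"
  proof (rule sum.cong[OF refl])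
    fix v assume v: "v \<in> V"
    show "(\<Sum>S\<in>Pow (V - {v}). ?w (card S) * f (insert v S))
      = (\<Sum>A\<in>{A\<in>Pow V. v \<in> A}. ?w (card A - 1) * f A)"
    proof (rule sum.reindex_bij_witness[of _ "\<lambda>A. A - {v}" "insert v"])
      fix S assume S: "S \<in> Pow (V - {v})"
      then have "finite S" "v \<notin> S" using assms finite_subset[of S V] by auto
      then show "?w (card (insert v S) - 1) * f (insert v S) = ?w (card S) * f (insert v S)" by simp
    qed (use v in \<open>auto simp: insert_absorb\<close>)
  qed
  also have "\<dots> = (\<Sum>A\<in>Pow V. \<Sum>v\<in>{v\<in>V. v \<in> A}. ?w (card A - 1) * f A)"
    using assms by (intro sum.swap_restrict) auto
  also have "\<dots> = (\<Sum>A\<in>Pow V. u A * f A - (if A = {} then f {} else 0))"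
  proof (rule sum.cong[OF refl])
    fix A assume A: "A \<in> Pow V"
    then have eq: "{v\<in>V. v \<in> A} = A" and fin: "finite A" and le: "card A \<le> ?n"
      using assms finite_subset card_mono[of V A] by auto
    show "(\<Sum>v\<in>{v\<in>V. v \<in> A}. ?w (card A - 1) * f A) = u A * f A - (if A = {} then f {} else 0)"
    proof (cases "A = {}")
      case True
      then show ?thesis by (simp add: u_def)
    next
      case False
      then obtain m where m: "card A = Suc m" using fin by (metis card_eq_0_iff not0_implies_Suc)
      then have "?n - 1 - m = ?n - card A" "Suc (?n - 1) = ?n" using n by auto
      then have "u A = real (Suc m) * ?w m" unfolding u_def shapley_def m by simp
      then show ?thesis unfolding eq using m False by simp
    qed
  qed
  also have "\<dots> = (\<Sum>A\<in>Pow V. u A * f A) - f {}"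
    using assms by (simp add: sum_subtractf)
  finally have 1: "(\<Sum>v\<in>V. \<Sum>S\<in>Pow (V - {v}). ?w (card S) * f (insert v S))
    = (\<Sum>A\<in>Pow V. u A * f A) - f {}" .
  have "(\<Sum>v\<in>V. \<Sum>S\<in>Pow (V - {v}). ?w (card S) * f S)
    = (\<Sum>v\<in>V. \<Sum>A\<in>{A\<in>Pow V. v \<notin> A}. ?w (card A) * f A)"
    by (intro sum.cong) auto
  also have "\<dots> = (\<Sum>A\<in>Pow V. \<Sum>v\<in>{v\<in>V. v \<notin> A}. ?w (card A) * f A)"
    using assms by (intro sum.swap_restrict) auto
  also have "\<dots> = (\<Sum>A\<in>Pow V. u A * f A - (if A = V then f V else 0))"
  proof (rule sum.cong[OF refl])
    fix A assume A: "A \<in> Pow V"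
    then have eq: "{v\<in>V. v \<notin> A} = V - A" and fin: "finite A" and le: "card A \<le> ?n"
      using assms finite_subset card_mono[of V A] by auto
    show "(\<Sum>v\<in>{v\<in>V. v \<notin> A}. ?w (card A) * f A) = u A * f A - (if A = V then f V else 0)"
    proof (cases "A = V")
      case True
      then show ?thesis by (simp add: u_def)
    next
      case False
      then have "card A < ?n" using A assms by (metis PowD psubset_card_mono psubsetI)
      then obtain m where m: "?n - card A = Suc m" by (metis Suc_pred zero_less_diff)
      then have "?n - 1 - card A = m" "Suc (?n - 1) = ?n" using n by auto
      then have "u A = real (Suc m) * ?w (card A)" unfolding u_def shapley_def m by simp
      moreover have "card (V - A) = Suc m" using m A fin by (simp add: card_Diff_subset)
      ultimately show ?thesis unfolding eq using False by simp
    qed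
  qed
  also have "\<dots> = (\<Sum>A\<in>Pow V. u A * f A) - f V"
    using assms by (simp add: sum_subtractf)
  finally have 2: "(\<Sum>v\<in>V. \<Sum>S\<in>Pow (V - {v}). ?w (card S) * f S)
    = (\<Sum>A\<in>Pow V. u A * f A) - f V" .
  have "(\<Sum>v\<in>V. \<Sum>S\<in>Pow (V - {v}). shapley (card (V - {v})) (card S) * (f (insert v S) - f S))
    = (\<Sum>v\<in>V. \<Sum>S\<in>Pow (V - {v}). ?w (card S) * f (insert v S))
      - (\<Sum>v\<in>V. \<Sum>S\<in>Pow (V - {v}). ?w (card S) * f S)"
    using cardm by (simp add: right_diff_distrib sum_subtractf)
  then show ?thesis using 1 2 by simp
qed simp

text \<open>If some \<open>N - {x}\<close> is a clique, each \<open>j\<close>-set through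
  \<open>x\<close> is a non-clique: otherwise it would share \<open>j - 1 \<ge> d\<close> vertices
  with \<open>N - {x}\<close>, and gluing would make \<open>N\<close> a clique. This case attains
  the bound. If there is no such \<open>x\<close>, the bounds for all \<open>N - {x}\<close> are
  averaged.\<close>

lemma nonclique_count:
  fixes clq :: "'a set \<Rightarrow> bool"
  assumes "finite N" "\<not> clq N" "d + 1 \<le> j" "j \<le> card N"
    and "\<And>A B. A \<subseteq> N \<Longrightarrow> B \<subseteq> N \<Longrightarrow> clq A \<Longrightarrow> clq B \<Longrightarrow> d \<le> card (A \<inter> B) \<Longrightarrow> clq (A \<union> B)"
  shows "(card N - 1) choose (j - 1) \<le> card {T. T \<subseteq> N \<and> card T = j \<and> \<not> clq T}"
  using assms
proof (induction N rule: finite_psubset_induct)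
  case (psubset N)
  let ?C = "\<lambda>M. {T. T \<subseteq> M \<and> card T = j \<and> \<not> clq T}"
  let ?k = "card N"
  have finC: "finite (?C N)" using psubset.hyps by auto
  consider "j = ?k" | x where "j < ?k" "x \<in> N" "clq (N - {x})"
    | "j < ?k" "\<And>x. x \<in> N \<Longrightarrow> \<not> clq (N - {x})"
    using psubset.prems(3) le_neq_implies_less by blast
  then show ?case
  proof cases
    case 1
    then have "{N} \<subseteq> ?C N" using psubset.prems by auto
    then have "card {N} \<le> card (?C N)" using finC by (rule card_mono[rotated])
    then show ?thesis using 1 by simp
  next
    case 2
    let ?A = "{T. T \<subseteq> N - {x} \<and> card T = j - 1}"
    have finT: "finite T" if "T \<subseteq> N" for T using that psubset.hyps finite_subset by blast
    have "insert x ` ?A \<subseteq> ?C N"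
    proof safe
      fix T assume T: "T \<subseteq> N - {x}" "card T = j - 1"
      then have fT: "finite T" "x \<notin> T" using finT by auto
      show "card (insert x T) = j" using T fT psubset.prems by simp
      show "y \<in> N" if "y \<in> T" for y using that T by auto
      assume c: "clq (insert x T)"
      have "insert x T \<inter> (N - {x}) = T" using T by auto
      then have "clq (insert x T \<union> (N - {x}))"
        using 2 c T psubset.prems(2) by (intro psubset.prems(4)) auto
      moreover have "insert x T \<union> (N - {x}) = N" using T 2 by auto
      ultimately show False using psubset.prems by simp
    qed (use 2 in auto)
    then have "card (insert x ` ?A) \<le> card (?C N)" using finC card_mono by blast
    moreover have "card (insert x ` ?A) = card ?A"
      by (intro card_image inj_onI) (metis (mono_tags, lifting) Diff_insert_absorb insert_absorb mem_Collect_eq subset_Diff_insert insert_ident)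
    moreover have "card ?A = (card (N - {x})) choose (j - 1)"
      using psubset.hyps by (intro n_subsets) auto
    ultimately show ?thesis using 2 psubset.hyps by simp
  next
    case 3
    have "(?k - 2) choose (j - 1) \<le> card (?C (N - {x}))" if x: "x \<in> N" for x
    proof -
      have card: "card (N - {x}) = ?k - 1" using x psubset.hyps by simp
      have "(card (N - {x}) - 1) choose (j - 1) \<le> card (?C (N - {x}))"
      proof (rule psubset.IH)
        show "N - {x} \<subset> N" using x by auto
        show "clq (A \<union> B)" if "A \<subseteq> N - {x}" "B \<subseteq> N - {x}" "clq A" "clq B" "d \<le> card (A \<inter> B)" for A B
          using that by (intro psubset.prems(4)) auto
      qed (use 3 x card psubset.prems in auto)
      then show ?thesis using card by (simp add: numeral_2_eq_2)
    qed
    \<comment> \<open>Double counting: a \<open>j\<close>-set is found in \<open>N - {x}\<close> for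
      exactly \<open>?k - j\<close> choices of \<open>x\<close>.\<close>
    then have "(\<Sum>x\<in>N. (?k - 2) choose (j - 1)) \<le> (\<Sum>x\<in>N. card (?C (N - {x})))"
      by (rule sum_mono)
    also have "\<dots> = (\<Sum>x\<in>N. \<Sum>T\<in>{T\<in>?C N. x \<notin> T}. 1)"
      by (intro sum.cong refl) (auto intro!: arg_cong[where f = card])
    also have "\<dots> = (\<Sum>T\<in>?C N. \<Sum>x\<in>{x\<in>N. x \<notin> T}. 1)"
      using psubset.hyps finC by (rule sum.swap_restrict)
    also have "\<dots> = (\<Sum>T\<in>?C N. ?k - j)"
    proof (rule sum.cong[OF refl])
      fix T assume T: "T \<in> ?C N"
      have "{x\<in>N. x \<notin> T} = N - T" by auto
      then show "(\<Sum>x\<in>{x\<in>N. x \<notin> T}. 1) = ?k - j"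
        using T psubset.hyps by (auto simp: card_Diff_subset finite_subset)
    qed
    finally have "?k * ((?k - 2) choose (j - 1)) \<le> card (?C N) * (?k - j)" by simp
    moreover have "((?k - 1) choose (j - 1)) * (?k - j) \<le> ?k * ((?k - 2) choose (j - 1))"
    proof -
      have "?k - 1 - (j - 1) = ?k - j" "?k - 1 - 1 = ?k - 2" using 3 psubset.prems by auto
      then have "((?k - 1) choose (j - 1)) * (?k - j) = (?k - 1) * ((?k - 2) choose (j - 1))"
        using binomial_absorb_comp[of "?k - 1" "j - 1"] by (simp add: mult.commute)
      then show ?thesis by simp
    qed
    ultimately have "((?k - 1) choose (j - 1)) * (?k - j) \<le> card (?C N) * (?k - j)"
      by (rule le_trans[rotated])
    then show ?thesis using 3 by simp
  qed
qed

lemma sum_Pow_by_card: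
  assumes "finite N"
  shows "(\<Sum>T\<in>Pow N. q T) = (\<Sum>j\<le>card N. \<Sum>T\<in>{T. T \<subseteq> N \<and> card T = j}. q T :: real)"
proof -
  have "(\<Sum>T\<in>Pow N. q T) = (\<Sum>j\<le>card N. \<Sum>T\<in>{T\<in>Pow N. card T = j}. q T)"
    using assms by (intro sum.group[symmetric]) (auto intro: card_mono)
  then show ?thesis by simp
qed

lemma sum_min: "real (\<Sum>j\<le>k. min j d) = real d * (real k + 1) - real d * (real d + 1) / 2" if "d \<le> k"
  using that
proof (induction k rule: dec_induct)
  case base
  have "(\<Sum>j\<le>d. min j d) = (\<Sum>j\<le>d. j)" by (intro sum.cong) auto
  moreover have "2 * (\<Sum>j\<le>d. j) = d * (d + 1)" by (induction d) auto
  then have "2 * real (\<Sum>j\<le>d. j) = real d * (real d + 1)" by (metis of_nat_1 of_nat_add of_nat_mult of_nat_numeral)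
  ultimately show ?case by (simp add: field_simps)
next
  case (step k)
  then have "min (Suc k) d = d" by simp
  then show ?case using step by (simp add: algebra_simps)
qed

text \<open>The number \<open>j\<close> of earlier neighbours is uniform on \<open>0..k\<close> for
  \<open>k = card N\<close>, and by \<open>count\<close> at least the fraction \<open>j / k\<close>
  of the \<open>j\<close>-sets are non-cliques. The 0-extensions fall short of \<open>d\<close> by
  \<open>d * (d + 1) / (2 * (k + 1))\<close> on average, and the bonus for non-cliques makes up for
  it exactly when \<open>k \<ge> d * (d + 1)\<close>.\<close>

lemma average_increment:
  fixes clq :: "'a set \<Rightarrow> bool"
  assumes fin: "finite N" and d: "d \<ge> 1" and k: "d * (d + 1) \<le> card N"
    and count: "\<And>j. d + 1 \<le> j \<Longrightarrow> j \<le> card N \<Longrightarrow>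
      (card N - 1) choose (j - 1) \<le> card {T. T \<subseteq> N \<and> card T = j \<and> \<not> clq T}"
  shows "real d \<le> (\<Sum>T\<in>Pow N. shapley (card N) (card T) *
    (real (min (card T) d) + (if d + 1 \<le> card T \<and> \<not> clq T then 1 else 0)))"
proof -
  let ?k = "card N"
  have kd: "d + 1 \<le> ?k" using k d by (metis le_trans mult_1 mult_le_mono1)
  \<comment> \<open>The bonus term is the probability \<open>1 / (k + 1)\<close> of level
    \<open>j\<close> times the guaranteed fraction \<open>j / k\<close> of non-cliques.\<close>
  have level: "(\<Sum>T\<in>{T. T \<subseteq> N \<and> card T = j}. shapley ?k (card T) *
      (real (min (card T) d) + (if d + 1 \<le> card T \<and> \<not> clq T then 1 else 0)))
    \<ge> real (min j d) / (?k + 1) + (if d + 1 \<le> j then real j / (real ?k * (?k + 1)) else 0)" (is "?L \<ge> ?R")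
    if j: "j \<le> ?k" for j
  proof -
    let ?S = "{T. T \<subseteq> N \<and> card T = j}"
    have finS: "finite ?S" using fin by auto
    have "?L = (\<Sum>T\<in>?S. shapley ?k j * real (min j d) + shapley ?k j * (if d + 1 \<le> j \<and> \<not> clq T then 1 else 0))"
      by (intro sum.cong) (auto simp: algebra_simps)
    also have "\<dots> = shapley ?k j * real (?k choose j) * real (min j d)
        + shapley ?k j * (\<Sum>T\<in>?S. if d + 1 \<le> j \<and> \<not> clq T then 1 else 0)"
      by (simp add: sum.distrib n_subsets[OF fin] sum_distrib_left)
    also have "shapley ?k j * real (?k choose j) * real (min j d) = real (min j d) / (?k + 1)"
      using shapley_binomial[OF j] by simp
    finally have L: "?L = real (min j d) / (?k + 1)
      + shapley ?k j * (\<Sum>T\<in>?S. if d + 1 \<le> j \<and> \<not> clq T then 1 else 0)" .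
    show ?thesis
    proof (cases "d + 1 \<le> j")
      case True
      have "(\<Sum>T\<in>?S. if d + 1 \<le> j \<and> \<not> clq T then 1 else 0 :: real) = real (card {T\<in>?S. \<not> clq T})"
        using True finS by (simp add: sum.If_cases Int_def)
      also have "{T\<in>?S. \<not> clq T} = {T. T \<subseteq> N \<and> card T = j \<and> \<not> clq T}" by auto
      finally have "(\<Sum>T\<in>?S. if d + 1 \<le> j \<and> \<not> clq T then 1 else 0 :: real) \<ge> real ((?k - 1) choose (j - 1))"
        using count[OF True j] by simp
      moreover have "real ((?k - 1) choose (j - 1)) = real (?k choose j) * j / ?k"
      proof -
        have "real j * real (?k choose j) = real ?k * real ((?k - 1) choose (j - 1))"
          using times_binomial_minus1_eq[of j ?k] True by (metis add_gr_0 less_le_trans of_nat_mult zero_less_one)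
        then show ?thesis using kd by (simp add: field_simps)
      qed
      moreover have "shapley ?k j \<ge> 0" by (simp add: shapley_def)
      ultimately have "shapley ?k j * (\<Sum>T\<in>?S. if d + 1 \<le> j \<and> \<not> clq T then 1 else 0)
        \<ge> shapley ?k j * (real (?k choose j) * j / ?k)"
        by (intro mult_left_mono) linarith+
      also have "shapley ?k j * (real (?k choose j) * j / ?k) = real j / (real ?k * (?k + 1))"
        using arg_cong[OF shapley_binomial[OF j], of "\<lambda>x. x * (real j / ?k)"] by (simp add: mult_ac)
      finally show ?thesis using L True by simp
    next
      case False
      then show ?thesis using L by simp
    qed
  qed
  have "real d \<le> (\<Sum>j\<le>?k. real (min j d) / (?k + 1) + (if d + 1 \<le> j then real j / (real ?k * (?k + 1)) else 0))"
  proof -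
    have 1: "(\<Sum>j\<le>?k. real (min j d) / (?k + 1)) = (real d * (real ?k + 1) - real d * (real d + 1) / 2) / (?k + 1)"
      using sum_min[of d ?k] kd by (simp flip: sum_divide_distrib)
    have "(\<Sum>j\<le>?k. if d + 1 \<le> j then real j else 0) = (\<Sum>j\<le>?k. real j) - (\<Sum>j\<le>d. real j)"
    proof -
      have "(\<Sum>j\<le>?k. if d + 1 \<le> j then real j else 0) + (\<Sum>j\<le>?k. if j \<le> d then real j else 0) = (\<Sum>j\<le>?k. real j)"
        unfolding sum.distrib[symmetric] by (intro sum.cong) auto
      moreover have "(\<Sum>j\<le>?k. if j \<le> d then real j else 0) = (\<Sum>j\<le>d. real j)"
        using kd by (intro sum.mono_neutral_cong_right) auto
      ultimately show ?thesis by linarith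
    qed
    also have "\<dots> = (real ?k * (real ?k + 1) - real d * (real d + 1)) / 2"
    proof -
      have "(\<Sum>j\<le>m. real j) = real m * (real m + 1) / 2" for m by (induction m) (auto simp: field_simps)
      then show ?thesis by (simp only: diff_divide_distrib)
    qed
    finally have "(\<Sum>j\<le>?k. if d + 1 \<le> j then real j else 0) / (real ?k * (?k + 1))
      = (real ?k * (real ?k + 1) - real d * (real d + 1)) / 2 / (real ?k * (?k + 1))"
      by (rule arg_cong)
    moreover have "(\<Sum>j\<le>?k. if d + 1 \<le> j then real j / (real ?k * (?k + 1)) else 0)
      = (\<Sum>j\<le>?k. if d + 1 \<le> j then real j else 0) / (real ?k * (?k + 1))"
      unfolding sum_divide_distrib by (intro sum.cong) auto
    ultimately have 2: "(\<Sum>j\<le>?k. if d + 1 \<le> j then real j / (real ?k * (?k + 1)) else 0)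
      = (real ?k * (real ?k + 1) - real d * (real d + 1)) / 2 / (real ?k * (?k + 1))" by simp
    have "real d * (real d + 1) \<le> ?k" using k
      by (metis of_nat_1 of_nat_add of_nat_le_iff of_nat_mult)
    \<comment> \<open>The sum of both averages in closed form, with \<open>K\<close> for the degree
      and \<open>D\<close> for \<open>d * (d + 1)\<close>; it is at least \<open>d\<close> as soon
      as \<open>K \<ge> D\<close>.\<close>
    moreover have "(real d * (K + 1) - D / 2) / (K + 1) + (K * (K + 1) - D) / 2 / (K * (K + 1)) = real d + (K - D) / (2 * K)"
      if "K > 0" for K D :: real
      using that by (simp add: divide_simps) (simp add: algebra_simps)
    from this[of "real ?k" "real d * (real d + 1)"] kd
    have "(\<Sum>j\<le>?k. real (min j d) / (?k + 1)) + (\<Sum>j\<le>?k. if d + 1 \<le> j then real j / (real ?k * (?k + 1)) else 0)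
      = real d + (real ?k - real d * (real d + 1)) / (2 * real ?k)"
      unfolding 1 2 by (simp add: add.commute)
    ultimately show ?thesis unfolding sum.distrib by simp
  qed
  also have "\<dots> \<le> (\<Sum>j\<le>?k. \<Sum>T\<in>{T. T \<subseteq> N \<and> card T = j}. shapley ?k (card T) *
      (real (min (card T) d) + (if d + 1 \<le> card T \<and> \<not> clq T then 1 else 0)))"
    using level by (intro sum_mono) auto
  finally show ?thesis using sum_Pow_by_card[OF fin] by simp
qed

section \<open>Highly connected graphs are rigid\<close>

definition nbrs :: "'a set set \<Rightarrow> 'a \<Rightarrow> 'a set" where
  "nbrs G v = {u. {v, u} \<in> G}"

definition del_vertex :: "'a \<Rightarrow> 'a set set \<Rightarrow> 'a set set" where
  "del_vertex v G = {e \<in> G. v \<notin> e}"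

lemma is_graph_mono: "is_graph G \<Longrightarrow> F \<subseteq> G \<Longrightarrow> is_graph F"
  by (auto simp: is_graph_def intro: finite_subset)

lemma is_graph_edge:
  assumes "is_graph G" "e \<in> G"
  obtains x y where "e = {x, y}" "x \<noteq> y"
  using assms by (auto simp: is_graph_def card_2_iff)

lemma nbrs_subset: "is_graph G \<Longrightarrow> nbrs G v \<subseteq> verts G - {v}"
  by (auto simp: nbrs_def verts_def is_graph_def)

lemma finite_nbrs: "is_graph G \<Longrightarrow> finite (nbrs G v)"
  by (meson finite_Diff finite_subset finite_verts nbrs_subset)

lemma not_in_nbrs: "is_graph G \<Longrightarrow> v \<notin> nbrs G v"
  using nbrs_subset by fastforce

lemma nbrs_nonempty:
  assumes "is_graph G" "v \<in> verts G"
  shows "nbrs G v \<noteq> {}"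
proof -
  obtain e where e: "e \<in> G" "v \<in> e" using assms by (auto simp: verts_def)
  then obtain x y where "e = {x, y}" using is_graph_edge[OF assms(1)] by metis
  then have "{v, if v = x then y else x} \<in> G" using e by (auto simp: insert_commute)
  then show ?thesis by (auto simp: nbrs_def)
qed

lemma star_nbrs:
  assumes "is_graph G"
  shows "star v (nbrs G v) = {e \<in> G. v \<in> e}"
proof
  show "star v (nbrs G v) \<subseteq> {e \<in> G. v \<in> e}" by (auto simp: star_def nbrs_def)
  show "{e \<in> G. v \<in> e} \<subseteq> star v (nbrs G v)"
  proof
    fix e assume e: "e \<in> {e \<in> G. v \<in> e}"
    then obtain x y where "e = {x, y}" using is_graph_edge[OF assms] by blast
    then have "e = {v, if v = x then y else x}" using e by auto
    then show "e \<in> star v (nbrs G v)" using e unfolding star_def nbrs_def by blast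
  qed
qed

lemma del_vertex_Un_star: "is_graph G \<Longrightarrow> del_vertex v G \<union> star v (nbrs G v) = G"
  by (auto simp: star_nbrs del_vertex_def)

lemma del_vertex_subset: "del_vertex v G \<subseteq> G"
  by (auto simp: del_vertex_def)

lemma not_in_verts_del_vertex: "v \<notin> verts (del_vertex v G)"
  by (auto simp: del_vertex_def verts_def)

lemma rtrancl_exit:
  assumes "(a, b) \<in> R\<^sup>*" "a \<in> Q" "b \<notin> Q"
  obtains x y where "(x, y) \<in> R" "x \<in> Q" "y \<notin> Q"
  using assms by (induction rule: rtrancl_induct) blast+

lemma k_connected_exit:
  assumes "k_connected k G" "X \<subseteq> verts G" "card X < k"
    and "z \<in> verts G" "z \<in> Q" "z \<notin> X" "u \<in> verts G" "u \<notin> X" "u \<notin> Q"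
  obtains x y where "{x, y} \<in> G" "x \<in> Q" "y \<notin> Q" "x \<notin> X" "y \<notin> X"
proof -
  have "(z, u) \<in> {(x, y). {x, y} \<in> G \<and> x \<notin> X \<and> y \<notin> X}\<^sup>*"
    using assms by (auto simp: k_connected_def connected_avoiding_def)
  then show ?thesis using assms that by (elim rtrancl_exit[of _ _ _ Q]) auto
qed

lemma k_connected_mono: "k_connected m G \<Longrightarrow> k \<le> m \<Longrightarrow> k_connected k G"
  by (auto simp: k_connected_def)

lemma k_connected_min_degree:
  assumes "is_graph G" "k_connected k G" "v \<in> verts G"
  shows "k \<le> card (nbrs G v)"
proof (rule ccontr)
  assume less: "\<not> k \<le> card (nbrs G v)"
  have fin: "finite (nbrs G v)" by (rule finite_nbrs[OF assms(1)])
  then have "card (insert v (nbrs G v)) < card (verts G)"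
    using less assms not_in_nbrs[of G v] by (auto simp: k_connected_def)
  then have "\<not> verts G \<subseteq> insert v (nbrs G v)"
    using fin by (metis card_mono finite_insert leD)
  then obtain u where u: "u \<in> verts G" "u \<notin> nbrs G v" "u \<noteq> v" by auto
  have sub: "nbrs G v \<subseteq> verts G" "v \<notin> nbrs G v" using nbrs_subset[of G v] assms(1) by auto
  obtain x y where "{x, y} \<in> G" "x \<in> {v}" "y \<notin> nbrs G v"
    using u less sub assms(2,3) by (elim k_connected_exit[of k G "nbrs G v" v "{v}" u]) auto
  then show False by (auto simp: nbrs_def)
qed

text \<open>Since vertices exist only as ends of edges, a neighbour of \<open>v\<close> might vanish
  along with it. Minimum degree \<open>Suc m \<ge> 2\<close> prevents this.\<close>

lemma k_connected_del_vertex: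
  assumes G: "is_graph G" "k_connected (Suc m) G" "v \<in> verts G" and m: "m \<ge> 1"
  shows "verts (del_vertex v G) = verts G - {v}" "k_connected m (del_vertex v G)"
proof -
  show verts: "verts (del_vertex v G) = verts G - {v}"
  proof
    show "verts (del_vertex v G) \<subseteq> verts G - {v}" by (auto simp: verts_def del_vertex_def)
    show "verts G - {v} \<subseteq> verts (del_vertex v G)"
    proof
      fix u assume u: "u \<in> verts G - {v}"
      then have "Suc m \<le> card (nbrs G u)" using k_connected_min_degree[OF G(1,2)] by simp
      then have "\<not> nbrs G u \<subseteq> {v}" using m card_mono[of "{v}" "nbrs G u"] by auto
      then obtain w where "{u, w} \<in> G" "w \<noteq> v" by (auto simp: nbrs_def)
      then have "{u, w} \<in> del_vertex v G" using u by (auto simp: del_vertex_def)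
      then show "u \<in> verts (del_vertex v G)" by (auto simp: verts_def)
    qed
  qed
  have fin: "finite (verts G)" using G finite_verts by blast
  have "connected_avoiding (del_vertex v G) X" if X: "X \<subseteq> verts G - {v}" "card X < m" for X
  proof -
    have "finite X" using X fin by (meson finite_Diff finite_subset)
    then have "card (insert v X) < Suc m" using X by (simp add: card_insert_if)
    moreover have "insert v X \<subseteq> verts G" using G X by auto
    ultimately have "connected_avoiding G (insert v X)"
      using G(2) unfolding k_connected_def by blast
    moreover have "{(x, y). {x, y} \<in> G \<and> x \<notin> insert v X \<and> y \<notin> insert v X}
      = {(x, y). {x, y} \<in> del_vertex v G \<and> x \<notin> X \<and> y \<notin> X}"
      using not_in_verts_del_vertex[of v G] by (auto simp: del_vertex_def)
    ultimately show ?thesis unfolding connected_avoiding_def verts by auto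
  qed
  moreover have "card (verts G - {v}) > m"
  proof -
    have "Suc m < card (verts G)" using G(2) unfolding k_connected_def by blast
    then show ?thesis using card.remove[OF fin G(3)] by linarith
  qed
  ultimately show "k_connected m (del_vertex v G)" unfolding k_connected_def verts by blast
qed

context rigidity_matroid
begin

definition closed_on :: "'a set \<Rightarrow> 'a set set \<Rightarrow> bool" where
  "closed_on V C \<longleftrightarrow> C \<subseteq> all_edges V \<and> (\<forall>e\<in>all_edges V - C. rk (insert e C) \<noteq> rk C)"

definition closure_on :: "'a set \<Rightarrow> 'a set set \<Rightarrow> 'a set set" where
  "closure_on V G = {e \<in> all_edges V. rk (insert e G) = rk G}"

lemma closure_on_superset: "G \<subseteq> all_edges V \<Longrightarrow> G \<subseteq> closure_on V G"
  by (auto simp: closure_on_def insert_absorb)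

lemma rk_closure_on:
  assumes "finite V" "G \<subseteq> all_edges V"
  shows "rk (closure_on V G) = rk G"
proof -
  have "finite G" "finite (closure_on V G)"
    using assms finite_subset[OF assms(2)] by (auto simp: closure_on_def)
  then have "rk (G \<union> closure_on V G) = rk G"
    by (intro rk_Un_spanned) (auto simp: closure_on_def)
  then show ?thesis using closure_on_superset[OF assms(2)] by (simp add: sup.absorb2)
qed

lemma closed_on_closure_on:
  assumes "finite V" "G \<subseteq> all_edges V"
  shows "closed_on V (closure_on V G)"
  unfolding closed_on_def
proof (intro conjI ballI notI)
  show "closure_on V G \<subseteq> all_edges V" by (auto simp: closure_on_def)
  fix e assume e: "e \<in> all_edges V - closure_on V G"
    and eq: "rk (insert e (closure_on V G)) = rk (closure_on V G)"
  have fin: "finite G" "finite (closure_on V G)"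
    using assms finite_subset[OF assms(2)] by (auto simp: closure_on_def)
  have "rk (insert e G) \<le> rk (insert e (closure_on V G))"
    using fin closure_on_superset[OF assms(2)] by (intro rk_mono) auto
  moreover have "rk G \<le> rk (insert e G)" using fin by (intro rk_mono) auto
  ultimately have "rk (insert e G) = rk G" using eq rk_closure_on[OF assms] by simp
  then show False using e by (auto simp: closure_on_def)
qed

text \<open>An edge spanned by the part of \<open>C\<close> inside \<open>W\<close> is also spanned
  by \<open>C\<close>. This permits restricting a closed graph to its non-simplicial
  vertices.\<close>

lemma closed_on_induced:
  assumes "finite V" "closed_on V C" "W \<subseteq> V"
  shows "closed_on W (C \<inter> all_edges W)"
  unfolding closed_on_def
proof (intro conjI ballI notI)
  show "C \<inter> all_edges W \<subseteq> all_edges W" by auto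
  fix e assume e: "e \<in> all_edges W - C \<inter> all_edges W"
    and eq: "rk (insert e (C \<inter> all_edges W)) = rk (C \<inter> all_edges W)"
  have "finite C" using assms finite_subset[of C "all_edges V"] by (auto simp: closed_on_def)
  then have "rk (insert e C) = rk C" using spanned_mono[of C "C \<inter> all_edges W" e] eq by auto
  then show False using e assms all_edges_mono[of W V] by (auto simp: closed_on_def)
qed

lemma closed_on_is_graph: "finite V \<Longrightarrow> closed_on V C \<Longrightarrow> is_graph C"
  using finite_subset[of C "all_edges V"] by (auto simp: closed_on_def is_graph_def all_edges_def)

text \<open>With \<open>d\<close> common vertices, every pair across the two cliques completes a
  circuit on \<open>d + 2\<close> vertices and so lies in the closed graph. This is the gluing
  property required by \<open>nonclique_count\<close>.\<close>

lemma closed_clique_union: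
  assumes "finite V" "closed_on V C" "A \<subseteq> V" "B \<subseteq> V"
    and AB: "all_edges A \<subseteq> C" "all_edges B \<subseteq> C" "d \<le> card (A \<inter> B)"
  shows "all_edges (A \<union> B) \<subseteq> C"
proof
  have finC: "finite C" using assms(1,2) closed_on_is_graph is_graph_def by blast
  obtain D where D: "D \<subseteq> A \<inter> B" "card D = d" by (meson AB(3) obtain_subset_with_card_n)
  have cross: "{x, y} \<in> C" if xy: "x \<in> A - B" "y \<in> B - A" for x y
  proof (rule ccontr)
    assume "{x, y} \<notin> C"
    then have "rk (insert {x, y} C) \<noteq> rk C"
      using assms(2-4) xy pair_in_all_edges[of x y V] unfolding closed_on_def by blast
    moreover have "all_edges (insert x D) \<subseteq> C" "all_edges (insert y D) \<subseteq> C"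
      using AB D xy all_edges_mono[of "insert x D" A] all_edges_mono[of "insert y D" B] by auto
    then have "rk (insert {x, y} C) = rk C"
      using D xy finC by (intro missing_edge_spanned[where D = D]) auto
    ultimately show False by simp
  qed
  fix e assume "e \<in> all_edges (A \<union> B)"
  then obtain x y where xy: "e = {x, y}" "x \<noteq> y" "x \<in> A \<union> B" "y \<in> A \<union> B"
    by (rule all_edges_cases)
  consider "x \<in> A \<and> y \<in> A" | "x \<in> B \<and> y \<in> B" | "x \<in> A - B \<and> y \<in> B - A" | "y \<in> A - B \<and> x \<in> B - A"
    using xy by blast
  then show "e \<in> C"
  proof cases
    case 1 then show ?thesis using xy AB by auto
  next
    case 2 then show ?thesis using xy AB by auto
  next
    case 3 then show ?thesis using xy cross by blast
  next
    case 4 then show ?thesis using xy cross[of y x] by (simp add: insert_commute)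
  qed
qed

text \<open>A missing edge \<open>xy\<close> between earlier neighbours is not spanned, as
  \<open>C\<close> is closed, so it extends a basis independently. A 1-extension that trades it for
  \<open>d + 1\<close> edges at \<open>v\<close> then leaves the basis intact and gains
  \<open>d + 1\<close>.\<close>

lemma rk_increment:
  assumes V: "finite V" "closed_on V C" "S \<subseteq> V" "v \<in> V" "v \<notin> S"
  defines "T \<equiv> S \<inter> nbrs C v"
  shows "rk (C \<inter> all_edges S) + (min (card T) d + (if d + 1 \<le> card T \<and> \<not> all_edges T \<subseteq> C then 1 else 0))
    \<le> rk (C \<inter> all_edges (insert v S))"
proof -
  let ?F = "C \<inter> all_edges S"
  have fin: "finite S" "finite C" "finite T"
    using V closed_on_is_graph[OF V(1,2)] finite_subset[of S V] by (auto simp: is_graph_def T_def)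
  have vF: "v \<notin> verts ?F" using V(5) verts_subset[of ?F S] by auto
  have sub: "?F \<union> star v T \<subseteq> C \<inter> all_edges (insert v S)"
    using V(5) by (auto simp: all_edges_insert star_def T_def nbrs_def)
  then have le: "rk (?F \<union> star v T) \<le> rk (C \<inter> all_edges (insert v S))"
    using fin by (intro rk_mono) auto
  have vT: "v \<notin> T" using V(5) by (auto simp: T_def)
  show ?thesis
  proof (cases "d + 1 \<le> card T \<and> \<not> all_edges T \<subseteq> C")
    case False
    have "rk ?F + min (card T) d \<le> rk (?F \<union> star v T)"
      using fin vF vT by (intro rk_add_star) auto
    then show ?thesis using le False by auto
  next
    case True
    then obtain e where "e \<in> all_edges T" "e \<notin> C" by auto
    then obtain x y where xy: "x \<noteq> y" "x \<in> T" "y \<in> T" "{x, y} \<notin> C"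
      by (metis all_edges_cases)
    have "{x, y} \<in> all_edges S" "{x, y} \<in> all_edges V" using xy V(3) by (auto simp: T_def)
    then have "rk (insert {x, y} C) \<noteq> rk C" using V xy by (auto simp: closed_on_def)
    then have unsp: "rk (insert {x, y} ?F) \<noteq> rk ?F"
      using spanned_mono[of C ?F "{x, y}"] fin by auto
    have finF: "finite ?F" using fin by auto
    obtain B where B: "B \<subseteq> ?F" "indep B" "card B = rk ?F" using rk_attained[OF finF] by blast
    have ind: "indep (insert {x, y} B)" by (rule indep_insert_unspanned[OF finF B(2,1,3) unsp])
    have "card (T - {x, y}) = card T - 2" using xy fin by (simp add: card_Diff_subset)
    then have "d - 1 \<le> card (T - {x, y})" using True by auto
    \<comment> \<open>Together with \<open>x\<close> and \<open>y\<close> these \<open>d - 1\<close>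
      vertices are the \<open>d + 1\<close> neighbours of the 1-extension.\<close>
    then obtain M where M: "M \<subseteq> T - {x, y}" "card M = d - 1" by (meson obtain_subset_with_card_n)
    let ?N = "insert x (insert y M)"
    have finM: "finite M" using M fin by (meson finite_Diff finite_subset)
    have cardN: "card ?N = d + 1" using M finM xy d_pos by (auto simp: card_insert_if)
    have NT: "?N \<subseteq> T" using M xy by auto
    have "v \<notin> verts (insert {x, y} B)"
      using vF B xy vT by (auto simp: verts_def)
    moreover have "{x, y} \<notin> B" using B xy by auto
    ultimately have ext: "indep (B \<union> star v ?N)"
      using ind NT vT cardN by (intro one_extension[of x y]) auto
    moreover have "B \<union> star v ?N \<subseteq> ?F \<union> star v T" using B NT by (auto simp: star_def)
    ultimately have "card (B \<union> star v ?N) \<le> rk (?F \<union> star v T)"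
      using fin by (intro rk_ge) auto
    moreover have "B \<inter> star v ?N = {}" using vF B by (auto simp: star_def verts_def)
    then have "card (B \<union> star v ?N) = rk ?F + (d + 1)"
      using B finM indep_finite[OF B(2)] cardN by (subst card_Un_disjoint) (auto simp: card_star)
    ultimately show ?thesis using True le by simp
  qed
qed

text \<open>Average the rank increments over a uniformly random order in which the vertices are added;
  the Shapley weights are the probabilities that a given set precedes a given vertex.\<close>

lemma rk_closed_ge:
  assumes V: "finite V" "closed_on V C"
    and deg: "\<And>v. v \<in> V \<Longrightarrow> d * (d + 1) \<le> card (nbrs C v)"
    and nonclique: "\<And>v. v \<in> V \<Longrightarrow> \<not> all_edges (nbrs C v) \<subseteq> C"
  shows "d * card V \<le> rk C"
proof -
  have graph: "is_graph C" using V closed_on_is_graph by blast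
  have CV: "C \<subseteq> all_edges V" using V by (auto simp: closed_on_def)
  define f where "f S = real (rk (C \<inter> all_edges S))" for S
  let ?h = "\<lambda>T. real (min (card T) d) + (if d + 1 \<le> card T \<and> \<not> all_edges T \<subseteq> C then 1 else 0)"
  have "real d \<le> (\<Sum>S\<in>Pow (V - {v}). shapley (card (V - {v})) (card S) * (f (insert v S) - f S))"
    if v: "v \<in> V" for v
  proof -
    let ?N = "nbrs C v"
    have N: "?N \<subseteq> V - {v}" using nbrs_subset[OF graph, of v] verts_subset[OF CV] by auto
    have finN: "finite ?N" by (rule finite_nbrs[OF graph])
    have "real d \<le> (\<Sum>T\<in>Pow ?N. shapley (card ?N) (card T) * ?h T)"
    proof (rule average_increment[OF finN d_pos deg[OF v]])
      fix j assume j: "d + 1 \<le> j" "j \<le> card ?N"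
      show "(card ?N - 1) choose (j - 1) \<le> card {T. T \<subseteq> ?N \<and> card T = j \<and> \<not> all_edges T \<subseteq> C}"
      proof (rule nonclique_count[where clq = "\<lambda>T. all_edges T \<subseteq> C", OF finN nonclique[OF v] j])
        show "all_edges (A \<union> B) \<subseteq> C"
          if "A \<subseteq> ?N" "B \<subseteq> ?N" "all_edges A \<subseteq> C" "all_edges B \<subseteq> C" "d \<le> card (A \<inter> B)" for A B
          using that N by (intro closed_clique_union[OF V]) auto
      qed
    qed
    also have "\<dots> = (\<Sum>S\<in>Pow (V - {v}). shapley (card (V - {v})) (card S) * ?h (S \<inter> ?N))"
      using V N by (intro shapley_marginal[symmetric]) auto
    also have "\<dots> \<le> (\<Sum>S\<in>Pow (V - {v}). shapley (card (V - {v})) (card S) * (f (insert v S) - f S))"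
    proof (intro sum_mono mult_left_mono)
      fix S assume "S \<in> Pow (V - {v})"
      then have "rk (C \<inter> all_edges S) + (min (card (S \<inter> ?N)) d
          + (if d + 1 \<le> card (S \<inter> ?N) \<and> \<not> all_edges (S \<inter> ?N) \<subseteq> C then 1 else 0))
        \<le> rk (C \<inter> all_edges (insert v S))"
        using V v by (intro rk_increment) auto
      then have "real (rk (C \<inter> all_edges S) + (min (card (S \<inter> ?N)) d
          + (if d + 1 \<le> card (S \<inter> ?N) \<and> \<not> all_edges (S \<inter> ?N) \<subseteq> C then 1 else 0)))
        \<le> real (rk (C \<inter> all_edges (insert v S)))"
        by (rule of_nat_mono)
      then show "?h (S \<inter> ?N) \<le> f (insert v S) - f S" unfolding f_def by (auto split: if_splits)
    qed (simp add: shapley_def)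
    finally show ?thesis .
  qed
  then have "(\<Sum>v\<in>V. real d)
    \<le> (\<Sum>v\<in>V. \<Sum>S\<in>Pow (V - {v}). shapley (card (V - {v})) (card S) * (f (insert v S) - f S))"
    by (rule sum_mono)
  also have "\<dots> = f V - f {}" using V by (intro shapley_efficiency)
  also have "\<dots> = real (rk C)" using CV by (simp add: f_def inf.absorb1)
  finally have "real (d * card V) \<le> real (rk C)" by (simp add: mult.commute)
  then show ?thesis by (simp only: of_nat_le_iff)
qed

text \<open>Otherwise \<open>d * card V \<le> rk C\<close>, whereas even the complete graph has rank
  at most \<open>d * (card V - 1)\<close>.\<close>

lemma closed_has_simplicial_or_small_degree:
  assumes "finite V" "closed_on V C" "V \<noteq> {}"
  obtains v where "v \<in> V" "card (nbrs C v) < d * (d + 1) \<or> all_edges (nbrs C v) \<subseteq> C"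
proof (rule ccontr)
  assume no: "\<not> thesis"
  have "d * card V \<le> rk C" using no that by (intro rk_closed_ge[OF assms(1,2)]) (meson not_less)+
  moreover have "rk C \<le> rho d (card V)" using assms by (intro rk_le_rho) (auto simp: closed_on_def)
  moreover have "rho d (card V) \<le> d * (card V - 1)" by (rule rho_le)
  moreover have "d * (card V - 1) < d * card V" using assms d_pos by (simp add: card_gt_0_iff)
  ultimately show False by linarith
qed

end

context rigidity_matroid
begin

text \<open>Passing to the non-simplicial vertices keeps all degrees large: by connectivity, the closed
  neighbourhood of a simplicial vertex contains \<open>d (d + 1)\<close> of them.\<close>

theorem connected_imp_rigid:
  assumes G: "is_graph G" "k_connected (d * (d + 1)) G"
  shows "rk G = rho d (card (verts G))"
proof -
  let ?k = "d * (d + 1)" and ?V = "verts G"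
  define C where "C = closure_on ?V G"
  have finV: "finite ?V" using G finite_verts by blast
  have GV: "G \<subseteq> all_edges ?V" using G is_graph_all_edges by blast
  have closed: "closed_on ?V C" unfolding C_def by (rule closed_on_closure_on[OF finV GV])
  have GC: "G \<subseteq> C" unfolding C_def by (rule closure_on_superset[OF GV])
  have CV: "C \<subseteq> all_edges ?V" using closed by (auto simp: closed_on_def)
  have graph: "is_graph C" using closed_on_is_graph[OF finV closed] .
  have kd: "d \<le> ?k" by simp
  have k0: "0 < ?k" using d_pos by simp
  have nbV: "nbrs C v \<subseteq> ?V" for v using nbrs_subset[OF graph, of v] verts_subset[OF CV] by auto
  have sym: "{x, y} \<in> C \<longleftrightarrow> {y, x} \<in> C" for x y by (simp add: insert_commute)
  have finnb: "finite (nbrs C v)" for v by (rule finite_nbrs[OF graph])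
  have "all_edges ?V \<subseteq> C"
  proof (rule ccontr)
    assume incomplete: "\<not> all_edges ?V \<subseteq> C"
    define simplicial where "simplicial v \<longleftrightarrow> all_edges (nbrs C v) \<subseteq> C" for v
    define V' where "V' = {v \<in> ?V. \<not> simplicial v}"
    define Q where "Q z = insert z (nbrs C z)" for z
    have QV: "Q z \<subseteq> ?V" if "z \<in> ?V" for z using nbV that by (auto simp: Q_def)
    have Qclique: "all_edges (Q z) \<subseteq> C" if "simplicial z" for z
      unfolding Q_def using that not_in_nbrs[OF graph, of z]
      by (subst all_edges_insert) (auto simp: simplicial_def star_def nbrs_def)
    have Qmem: "y \<in> Q z" if "{z, y} \<in> C" for y z using that by (simp add: Q_def nbrs_def)
    \<comment> \<open>If these were fewer than \<open>?k\<close> vertices, some edge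
      \<open>xy\<close> of \<open>G\<close> would leave \<open>Q z\<close> from a simplicial
      \<open>x\<close>. As \<open>z\<close> and \<open>y\<close> are then both in the clique around
      \<open>x\<close> (or \<open>x = z\<close>), \<open>y\<close> would belong to
      \<open>Q z\<close> after all.\<close>
    have big: "?k \<le> card (Q z \<inter> V')" if z: "z \<in> ?V" "simplicial z" for z
    proof (rule ccontr)
      assume "\<not> ?k \<le> card (Q z \<inter> V')"
      then have less: "card (Q z \<inter> V') < ?k" by simp
      have "\<not> ?V \<subseteq> Q z" using incomplete Qclique[OF z(2)] all_edges_mono by blast
      then obtain u where u: "u \<in> ?V" "u \<notin> Q z" by auto
      obtain x y where xy: "{x, y} \<in> G" "x \<in> Q z" "y \<notin> Q z" "x \<notin> Q z \<inter> V'"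
      proof (rule k_connected_exit[OF G(2) _ less z(1) _ _ u(1) _ u(2)])
        show "Q z \<inter> V' \<subseteq> ?V" by (auto simp: V'_def)
        show "z \<in> Q z" by (simp add: Q_def)
        show "z \<notin> Q z \<inter> V'" using z by (simp add: V'_def)
        show "u \<notin> Q z \<inter> V'" using u by simp
      qed
      have "simplicial x" using xy QV z by (auto simp: V'_def)
      have xyC: "{x, y} \<in> C" using xy GC by auto
      show False
      proof (cases "x = z")
        case True
        then show False using Qmem xyC xy by blast
      next
        case False
        then have "z \<in> nbrs C x" "y \<in> nbrs C x" "z \<noteq> y"
          using xy xyC sym by (auto simp: Q_def nbrs_def)
        then have "{z, y} \<in> C" using \<open>simplicial x\<close> pair_in_all_edges[of z y "nbrs C x"]
          unfolding simplicial_def by blast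
        then show False using Qmem xy by blast
      qed
    qed
    have "?V \<noteq> {}" using G by (auto simp: k_connected_def)
    then obtain v0 where v0: "v0 \<in> ?V" by auto
    have V'0: "V' \<noteq> {}"
    proof (cases "v0 \<in> V'")
      case False
      then have "?k \<le> card (Q v0 \<inter> V')" using v0 by (intro big) (auto simp: V'_def)
      then show ?thesis using k0 by (metis Int_empty_right card.empty not_le)
    qed auto
    have V'V: "V' \<subseteq> ?V" by (auto simp: V'_def)
    have key: "?k \<le> card (nbrs C v \<inter> V') \<and> \<not> all_edges (nbrs C v \<inter> V') \<subseteq> C" if v: "v \<in> V'" for v
    proof (cases "nbrs C v \<subseteq> V'")
      case True
      have "?k \<le> card (nbrs G v)" using k_connected_min_degree[OF G] v V'V by auto
      also have "\<dots> \<le> card (nbrs C v)" using GC finnb by (intro card_mono) (auto simp: nbrs_def)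
      finally show ?thesis using True v by (auto simp: V'_def simplicial_def inf.absorb1)
    next
      case False
      then obtain z where z: "z \<in> nbrs C v" "z \<notin> V'" by auto
      then have zV: "z \<in> ?V" "simplicial z" using nbV[of v] by (auto simp: V'_def)
      have vQ: "v \<in> Q z" using z sym by (auto simp: Q_def nbrs_def)
      have glue: "{a, b} \<in> C" if "all_edges A \<subseteq> C" "all_edges B \<subseteq> C" "A \<subseteq> ?V" "B \<subseteq> ?V"
        "d \<le> card (A \<inter> B)" "a \<in> A" "b \<in> B" "a \<noteq> b" for A B a b
      proof -
        have "all_edges (A \<union> B) \<subseteq> C" using that by (intro closed_clique_union[OF finV closed])
        moreover have "{a, b} \<in> all_edges (A \<union> B)" using that by auto
        ultimately show ?thesis by blast
      qed
      \<comment> \<open>The set \<open>Q z \<inter> V'\<close> contains \<open>v\<close>, which is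
        not its own neighbour; a neighbour in \<open>V'\<close> outside \<open>Q z\<close> makes up
        for this loss of one.\<close>
      have "\<exists>y. y \<in> nbrs C v \<and> y \<in> V' \<and> y \<notin> Q z"
      proof -
        have "\<not> nbrs C v \<subseteq> Q z"
        proof
          assume "nbrs C v \<subseteq> Q z"
          then have "simplicial v" unfolding simplicial_def
            using Qclique[OF zV(2)] all_edges_mono by blast
          then show False using v by (simp add: V'_def)
        qed
        then obtain y0 where y0: "y0 \<in> nbrs C v" "y0 \<notin> Q z" by auto
        show ?thesis
        proof (cases "y0 \<in> V'")
          case True
          then show ?thesis using y0 by auto
        next
          case False
          then have s: "y0 \<in> ?V" "simplicial y0" using y0 nbV[of v] by (auto simp: V'_def)
          \<comment> \<open>Sharing \<open>d\<close> vertices, the cliques would glue and join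
            \<open>y0\<close> to \<open>z\<close>. Hence \<open>Q y0\<close>, which has at least
            \<open>?k\<close> members in \<open>V'\<close>, has one of them outside
            \<open>Q z\<close>, and that one is adjacent to \<open>v\<close> within
            \<open>Q y0\<close>.\<close>
          have "card (Q y0 \<inter> Q z) < d"
          proof (rule ccontr)
            assume "\<not> card (Q y0 \<inter> Q z) < d"
            then have "{z, y0} \<in> C"
              using Qclique s zV QV y0 by (intro glue[of "Q z" "Q y0"]) (auto simp: Q_def Int_commute)
            then show False using y0 Qmem by blast
          qed
          moreover have "finite (Q y0 \<inter> Q z)" using finnb by (simp add: Q_def)
          ultimately have "\<not> Q y0 \<inter> V' \<subseteq> Q y0 \<inter> Q z"
            using big[OF s] kd card_mono by (metis leD le_trans)
          then obtain y' where y': "y' \<in> Q y0" "y' \<in> V'" "y' \<notin> Q z" by auto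
          have "v \<in> Q y0" using y0 sym by (auto simp: Q_def nbrs_def)
          moreover have "v \<noteq> y'" using y' vQ by auto
          ultimately have "{v, y'} \<in> C"
            using Qclique[OF s(2)] y' pair_in_all_edges[of v y' "Q y0"] by blast
          then show ?thesis using y' by (auto simp: nbrs_def)
        qed
      qed
      then obtain y where y: "y \<in> nbrs C v" "y \<in> V'" "y \<notin> Q z" by blast
      have adj: "w \<in> nbrs C v" if "w \<in> Q z" "w \<noteq> v" for w
        using Qclique[OF zV(2)] that vQ pair_in_all_edges[of v w "Q z"] by (auto simp: nbrs_def)
      have finQ: "finite (Q z \<inter> V')" using finnb by (simp add: Q_def)
      have "insert y (Q z \<inter> V' - {v}) \<subseteq> nbrs C v \<inter> V'" using y adj by auto
      then have "card (insert y (Q z \<inter> V' - {v})) \<le> card (nbrs C v \<inter> V')"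
        using finnb by (intro card_mono) auto
      moreover have "card (insert y (Q z \<inter> V' - {v})) = card (Q z \<inter> V')"
        using y card.remove[OF finQ, of v] vQ v finQ by (subst card_insert_disjoint) auto
      ultimately have 1: "?k \<le> card (nbrs C v \<inter> V')" using big[OF zV] by linarith
      \<comment> \<open>Otherwise \<open>y\<close> would form a clique with
        \<open>Q z \<inter> V'\<close>, which has at least \<open>d\<close> vertices in common with
        \<open>Q z\<close>; gluing would then join \<open>y\<close> to \<open>z\<close>.\<close>
      have "\<not> all_edges (nbrs C v \<inter> V') \<subseteq> C"
      proof
        assume c: "all_edges (nbrs C v \<inter> V') \<subseteq> C"
        let ?A = "insert y (Q z \<inter> V')"
        have "star y (Q z \<inter> V') \<subseteq> C"
        proof
          fix e assume "e \<in> star y (Q z \<inter> V')"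
          then obtain w where w: "e = {y, w}" "w \<in> Q z" "w \<in> V'" by (auto simp: star_def)
          show "e \<in> C"
          proof (cases "w = v")
            case True
            then show ?thesis using w y sym by (auto simp: nbrs_def)
          next
            case False
            then have "{y, w} \<in> all_edges (nbrs C v \<inter> V')" using w y adj by auto
            then show ?thesis using w c by auto
          qed
        qed
        moreover have "all_edges (Q z \<inter> V') \<subseteq> C"
          using Qclique[OF zV(2)] all_edges_mono[of "Q z \<inter> V'" "Q z"] by auto
        ultimately have "all_edges ?A \<subseteq> C" using y by (subst all_edges_insert) auto
        moreover have "d \<le> card (Q z \<inter> ?A)"
        proof -
          have "Q z \<inter> ?A = Q z \<inter> V'" using y by auto
          then show ?thesis using big[OF zV] kd by simp
        qed
        ultimately have "{z, y} \<in> C"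
          using Qclique[OF zV(2)] QV[OF zV(1)] y V'V by (intro glue[of "Q z" ?A]) (auto simp: Q_def)
        then show False using Qmem y by blast
      qed
      then show ?thesis using 1 by simp
    qed
    let ?C' = "C \<inter> all_edges V'"
    have nb': "nbrs ?C' v = nbrs C v \<inter> V'" if "v \<in> V'" for v
      using that not_in_nbrs[OF graph, of v] by (auto simp: nbrs_def)
    obtain v where "v \<in> V'" "card (nbrs ?C' v) < ?k \<or> all_edges (nbrs ?C' v) \<subseteq> ?C'"
      using closed_has_simplicial_or_small_degree[OF finite_subset[OF V'V finV]
        closed_on_induced[OF finV closed V'V] V'0] by blast
    then show False using key nb' by (metis Int_subset_iff leD)
  qed
  then have "C = all_edges ?V" using CV by blast
  then show ?thesis using rk_closure_on[OF finV GV] rk_all_edges[OF finV] by (simp add: C_def)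
qed

section \<open>Vertical connectivity of the matroid versus vertex connectivity of the graph\<close>

lemma rk_del_vertex_add:
  assumes "is_graph G"
  shows "rk (del_vertex v G) + min (card (nbrs G v)) d \<le> rk G"
proof -
  have "rk (del_vertex v G) + min (card (nbrs G v)) d \<le> rk (del_vertex v G \<union> star v (nbrs G v))"
    using assms finite_nbrs[OF assms] not_in_nbrs[OF assms] not_in_verts_del_vertex[of v G]
    by (intro rk_add_star) (auto simp: is_graph_def intro: finite_subset[OF del_vertex_subset])
  then show ?thesis using del_vertex_Un_star[OF assms] by metis
qed

lemma card_nbrs_le_rk:
  assumes "is_graph G"
  shows "card (nbrs G v) \<le> rk G"
proof -
  have "rk (star v (nbrs G v)) \<le> rk G"
    using assms del_vertex_Un_star[OF assms] by (intro rk_mono) (auto simp: is_graph_def)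
  then show ?thesis using rk_star finite_nbrs[OF assms] not_in_nbrs[OF assms] by metis
qed

text \<open>Deleting a vertex incident with both sides lowers \<open>rk G\<close> by exactly
  \<open>d\<close>, since both graphs are rigid, but lowers the sum for the two sides by at least
  \<open>d + 1\<close>. If there is no such vertex, connectivity makes one side empty. The bound on
  \<open>m\<close> leaves \<open>d * (d + 1)\<close>-connectivity after \<open>k\<close>
  deletions.\<close>

lemma partition_rank:
  assumes "is_graph G" "k_connected m G" "d * (d + 1) + k \<le> m" "E1 \<union> E2 = G" "E1 \<inter> E2 = {}"
  shows "rk G + k \<le> rk E1 + rk E2 \<or> rk E1 = rk G \<or> rk E2 = rk G"
  using assms
proof (induction k arbitrary: G E1 E2 m)
  case 0
  have "finite E1" "finite E2" using 0 by (auto simp: is_graph_def)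
  then show ?case using 0 rk_Un_le[of E1 E2] by simp
next
  case (Suc k)
  note G = Suc.prems(1,2)
  have gr: "is_graph E1" "is_graph E2" using Suc.prems is_graph_mono by blast+
  have finG: "finite G" using G by (simp add: is_graph_def)
  have le: "rk E1 \<le> rk G" "rk E2 \<le> rk G" using Suc.prems finG by (auto intro: rk_mono)
  show ?case
  proof (cases "\<exists>x. nbrs E1 x \<noteq> {} \<and> nbrs E2 x \<noteq> {}")
    case True
    then obtain x where x: "nbrs E1 x \<noteq> {}" "nbrs E2 x \<noteq> {}" by blast
    obtain m' where m': "m = Suc m'" using Suc.prems(3) by (cases m) auto
    have m'1: "d * (d + 1) + k \<le> m'" using Suc.prems(3) m' by simp
    have dd: "d \<le> d * (d + 1)" "1 \<le> d * (d + 1)" using d_pos by auto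
    have m'0: "1 \<le> m'" using m'1 dd by linarith
    have xV: "x \<in> verts G" using x Suc.prems(4) by (auto simp: nbrs_def verts_def)
    let ?G = "del_vertex x G"
    have del: "verts ?G = verts G - {x}" "k_connected m' ?G"
      using k_connected_del_vertex[OF G(1) _ xV m'0] G(2) m' by auto
    have gr': "is_graph ?G" using is_graph_mono[OF G(1) del_vertex_subset] .
    have rkG: "rk G = rk ?G + d"
    proof -
      have c: "k_connected (d * (d + 1)) G" "k_connected (d * (d + 1)) ?G"
        using k_connected_mono[OF G(2)] k_connected_mono[OF del(2)] m'1 m' by auto
      have "card (verts G) = Suc (card (verts ?G))"
        using del(1) card.remove[OF finite_verts[OF G(1)] xV] by simp
      moreover have "d \<le> card (verts ?G)" using c(2) dd by (simp add: k_connected_def)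
      ultimately show ?thesis
        using connected_imp_rigid[OF G(1) c(1)] connected_imp_rigid[OF gr' c(2)] by (simp add: rho_Suc)
    qed
    let ?a = "card (nbrs E1 x)" and ?b = "card (nbrs E2 x)"
    have "nbrs G x = nbrs E1 x \<union> nbrs E2 x" "nbrs E1 x \<inter> nbrs E2 x = {}"
      using Suc.prems by (auto simp: nbrs_def)
    then have "card (nbrs G x) = ?a + ?b"
      using finite_nbrs[OF gr(1)] finite_nbrs[OF gr(2)] by (simp add: card_Un_disjoint)
    then have deg: "m \<le> ?a + ?b" using k_connected_min_degree[OF G xV] by simp
    have pos: "1 \<le> ?a" "1 \<le> ?b"
      using x finite_nbrs[OF gr(1), of x] finite_nbrs[OF gr(2), of x] by (auto simp: Suc_le_eq card_gt_0_iff)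
    have r: "rk (del_vertex x E1) + min ?a d \<le> rk E1" "rk (del_vertex x E2) + min ?b d \<le> rk E2"
      "?a \<le> rk E1" "?b \<le> rk E2"
      using rk_del_vertex_add card_nbrs_le_rk gr by blast+
    have "rk ?G + k \<le> rk (del_vertex x E1) + rk (del_vertex x E2)
      \<or> rk (del_vertex x E1) = rk ?G \<or> rk (del_vertex x E2) = rk ?G"
      using gr' del(2) m'1 Suc.prems(4,5) by (intro Suc.IH[of ?G m']) (auto simp: del_vertex_def)
    then show ?thesis
    proof (elim disjE)
      assume "rk ?G + k \<le> rk (del_vertex x E1) + rk (del_vertex x E2)"
      \<comment> \<open>Both degrees are positive and their sum is at least
        \<open>m > d\<close>.\<close>
      moreover have "d + 1 \<le> min ?a d + min ?b d"
        using pos deg m' m'1 dd d_pos by linarith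
      ultimately show ?thesis using r rkG by linarith
    next
      assume "rk (del_vertex x E1) = rk ?G"
      \<comment> \<open>If \<open>?a \<ge> d\<close>, the star at \<open>x\<close> brings
        \<open>E1\<close> up to \<open>rk G\<close>. Otherwise
        \<open>rk E1 \<ge> rk G - d + ?a\<close>, and the star of size
        \<open>?b \<ge> m - ?a\<close> inside \<open>E2\<close> supplies the rest.\<close>
      then show ?thesis using r rkG le deg Suc.prems(3) dd by linarith
    next
      assume "rk (del_vertex x E2) = rk ?G"
      then show ?thesis using r rkG le deg Suc.prems(3) dd by linarith
    qed
  next
    case False
    have "E1 = {} \<or> E2 = {}"
    proof (rule ccontr)
      assume "\<not> ?thesis"
      then obtain e f where ef: "e \<in> E1" "f \<in> E2" by auto
      obtain a a' where a: "e = {a, a'}" using is_graph_edge[OF gr(1) ef(1)] by blast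
      obtain c c' where c: "f = {c, c'}" using is_graph_edge[OF gr(2) ef(2)] by blast
      have "c \<in> nbrs E2 c \<or> c' \<in> nbrs E2 c" using ef c by (auto simp: nbrs_def)
      then have "c \<notin> verts E1" using False nbrs_nonempty[OF gr(1)] by blast
      moreover have "a \<in> verts E1" "a \<in> verts G" "c \<in> verts G"
        using ef a c Suc.prems(4) by (auto simp: verts_def)
      moreover have "card ({} :: 'a set) < m" using Suc.prems(3) by simp
      ultimately obtain x y where xy: "{x, y} \<in> G" "x \<in> verts E1" "y \<notin> verts E1"
        using k_connected_exit[OF G(2), of "{}" a "verts E1" c] by blast
      then have "{x, y} \<in> E2" using Suc.prems(4) by (auto simp: verts_def)
      then show False using False nbrs_nonempty[OF gr(1) xy(2)] by (auto simp: nbrs_def)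
    qed
    then show ?thesis using Suc.prems(4) by auto
  qed
qed

text \<open>Vertical \<open>K\<close>-connectivity of the matroid restricted to \<open>F\<close>, with the quantifier over the
  orders of the separations eliminated.\<close>

definition vconn :: "nat \<Rightarrow> 'a set set \<Rightarrow> bool" where
  "vconn K F \<longleftrightarrow> K \<le> rk F \<and> (\<forall>E1 E2. E1 \<union> E2 = F \<longrightarrow> E1 \<inter> E2 = {} \<longrightarrow>
     rk F + min (min (rk E1) (rk E2)) (K - 1) \<le> rk E1 + rk E2)"

text \<open>The surplus to be shown never exceeds \<open>K - 1\<close>, so \<open>K - 1\<close>
  deletions suffice. A side of full rank causes no trouble, as the surplus is also bounded by the
  rank of the other side.\<close>

lemma k_connected_imp_vconn:
  assumes G: "is_graph G" "k_connected m G" and m: "d * (d + 1) + (K - 1) \<le> m"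
  shows "vconn K G"
  unfolding vconn_def
proof (intro conjI allI impI)
  have dd: "2 \<le> d * (d + 1)" using d_pos mult_le_mono[of 1 d 2 "d + 1"] by simp
  have "k_connected (d * (d + 1)) G" using k_connected_mono[OF G(2)] m by simp
  then have "card (verts G) - 1 \<le> rk G"
    using connected_imp_rigid[OF G(1)] rho_ge[OF d_pos] by simp
  moreover have "m < card (verts G)" using G(2) by (simp add: k_connected_def)
  ultimately show "K \<le> rk G" using m dd by linarith
next
  fix E1 E2 assume E: "E1 \<union> E2 = G" "E1 \<inter> E2 = {}"
  let ?k = "min (min (rk E1) (rk E2)) (K - 1)"
  have "d * (d + 1) + ?k \<le> m" using m by linarith
  then have "rk G + ?k \<le> rk E1 + rk E2 \<or> rk E1 = rk G \<or> rk E2 = rk G"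
    using partition_rank[OF G _ E] by blast
  then show "rk G + ?k \<le> rk E1 + rk E2" by linarith
qed

text \<open>Separate the star of \<open>v\<close> from the other edges: the star has rank equal to
  the degree, and the rest has rank less than \<open>rk F\<close>. Either this excludes degrees
  below \<open>K\<close>, or the degree is at least \<open>rk F \<ge> K\<close>.\<close>

lemma vconn_min_degree:
  assumes F: "is_graph F" "vconn K F" "v \<in> verts F"
  shows "K \<le> card (nbrs F v)"
proof -
  let ?N = "nbrs F v" and ?E = "del_vertex v F"
  have fin: "finite ?N" by (rule finite_nbrs[OF F(1)])
  have pos: "1 \<le> card ?N" using nbrs_nonempty[OF F(1,3)] fin by (simp add: Suc_le_eq card_gt_0_iff)
  have "rk (star v ?N) = card ?N" using rk_star[OF fin not_in_nbrs[OF F(1)]] .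
  moreover have "?E \<union> star v ?N = F" "?E \<inter> star v ?N = {}"
    using del_vertex_Un_star[OF F(1)] star_nbrs[OF F(1)] by (auto simp: del_vertex_def)
  ultimately have "rk F + min (min (rk ?E) (card ?N)) (K - 1) \<le> rk ?E + card ?N" "K \<le> rk F"
    using F(2) unfolding vconn_def by metis+
  moreover have "rk ?E + 1 \<le> rk F" using rk_del_vertex_add[OF F(1), of v] pos d_pos by linarith
  ultimately show ?thesis using pos by linarith
qed

text \<open>A separator has at most \<open>c - 1\<close> vertices, hence rank defect at most
  \<open>d * (c - 2)\<close>, which is less than \<open>K - 1\<close>. Both sides have rank at least
  \<open>K\<close> because each contains a full star. The bound \<open>c \<le> K\<close> yields
  enough vertices.\<close>

lemma vconn_imp_k_connected:
  assumes F: "is_graph F" "vconn K F" and K: "d * (c - 2) + 2 \<le> K" "c \<le> K"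
  shows "k_connected c F"
  unfolding k_connected_def
proof (intro conjI allI impI)
  have finV: "finite (verts F)" using F finite_verts by blast
  have "F \<noteq> {}" using F K unfolding vconn_def by (metis add_leD2 le_zero_eq rk_empty zero_neq_numeral)
  then obtain w where w: "w \<in> verts F"
    using F(1) by (metis (no_types, lifting) Union_iff all_not_in_conv insertI1 is_graph_edge verts_def)
  have "card (nbrs F w) \<le> card (verts F - {w})"
    using nbrs_subset[OF F(1)] finV by (intro card_mono) auto
  also have "\<dots> < card (verts F)" by (rule card_Diff1_less[OF finV w])
  finally show "c < card (verts F)" using vconn_min_degree[OF F w] K by linarith
next
  have finV: "finite (verts F)" using F finite_verts by blast
  fix X assume X: "X \<subseteq> verts F \<and> card X < c"
  let ?R = "{(x, y). {x, y} \<in> F \<and> x \<notin> X \<and> y \<notin> X}"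
  show "connected_avoiding F X"
    unfolding connected_avoiding_def
  proof (intro ballI, rule ccontr)
    fix u v assume uv: "u \<in> verts F - X" "v \<in> verts F - X" "(u, v) \<notin> ?R\<^sup>*"
    define A where "A = {y. (u, y) \<in> ?R\<^sup>*}"
    define B where "B = verts F - X - A"
    have uA: "u \<in> A" by (simp add: A_def)
    have step: "y \<in> A" if "x \<in> A" "{x, y} \<in> F" "x \<notin> X" "y \<notin> X" for x y
      using that rtrancl_into_rtrancl[of u x ?R y] unfolding A_def by auto
    have A: "A \<subseteq> verts F - X"
    proof
      fix y assume "y \<in> A"
      then have "(u, y) \<in> ?R\<^sup>*" by (simp add: A_def)
      then show "y \<in> verts F - X"
        using uv(1) by (induction rule: rtrancl_induct) (auto simp: verts_def)
    qed
    have vB: "v \<in> B" using uv by (auto simp: B_def A_def)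
    \<comment> \<open>Edges inside the separator \<open>X\<close> go to the other side, so every
      edge at \<open>u\<close> is in \<open>E1\<close> and every edge at \<open>v\<close> in
      \<open>E2\<close>.\<close>
    define E1 where "E1 = {e \<in> F. e \<inter> A \<noteq> {}}"
    define E2 where "E2 = F - E1"
    have E: "E1 \<union> E2 = F" "E1 \<inter> E2 = {}" by (auto simp: E1_def E2_def)
    have E1: "E1 \<subseteq> all_edges (A \<union> X)"
    proof
      fix e assume e: "e \<in> E1"
      then obtain x where x: "x \<in> e" "x \<in> A" "e \<in> F" by (auto simp: E1_def)
      then have "e \<in> star x (nbrs F x)" using star_nbrs[OF F(1)] by auto
      then obtain y where y: "e = {x, y}" by (auto simp: star_def)
      then have "y \<in> A \<union> X" "x \<noteq> y"
        using step[of x y] x A not_in_nbrs[OF F(1), of x] by (auto simp: nbrs_def)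
      then show "e \<in> all_edges (A \<union> X)" using x y by auto
    qed
    have E2: "E2 \<subseteq> all_edges (X \<union> B)"
    proof
      fix e assume "e \<in> E2"
      then show "e \<in> all_edges (X \<union> B)"
        using F(1) by (auto simp: E1_def E2_def B_def all_edges_def is_graph_def verts_def)
    qed
    have fin: "finite X" "finite A" "finite B" using X A finV finite_subset by (auto simp: B_def)
    have "rk E1 + rk E2 \<le> rk (E1 \<union> E2) + rho d (card X)"
      using A fin E1 E2 by (intro rk_separation[of X A B]) (auto simp: B_def)
    moreover have "rho d (card X) \<le> d * (c - 2)"
      using rho_le[of d "card X"] X mult_le_mono2[of "card X - 1" "c - 2" d] by linarith
    moreover have "rk F + min (min (rk E1) (rk E2)) (K - 1) \<le> rk E1 + rk E2"
      using F(2) E by (auto simp: vconn_def)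
    moreover have "K \<le> rk E1"
    proof -
      have "star u (nbrs F u) \<subseteq> E1" using uA star_nbrs[OF F(1)] by (auto simp: E1_def)
      then have "nbrs F u = nbrs E1 u" by (auto simp: star_def nbrs_def E1_def)
      then show ?thesis
        using vconn_min_degree[OF F] uv card_nbrs_le_rk[OF is_graph_mono[OF F(1)], of E1 u] E by fastforce
    qed
    moreover have "K \<le> rk E2"
    proof -
      have "star v (nbrs F v) \<subseteq> E2"
      proof
        fix e assume "e \<in> star v (nbrs F v)"
        then obtain y where y: "e = {v, y}" "e \<in> F" by (auto simp: star_def nbrs_def)
        have "y \<notin> A" using step[of y v] A uv vB y by (auto simp: insert_commute B_def)
        then show "e \<in> E2" using y vB by (auto simp: E1_def E2_def B_def)
      qed
      then have "nbrs F v = nbrs E2 v" by (auto simp: star_def nbrs_def E2_def)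
      then show ?thesis
        using vconn_min_degree[OF F] uv card_nbrs_le_rk[OF is_graph_mono[OF F(1)], of E2 v] E by fastforce
    qed
    ultimately show False using E K by (simp add: min_def split: if_splits)
  qed
qed

end

section \<open>Linear independence at generic points\<close>

text \<open>One equation is solved for an unknown \<open>i0\<close> with nonzero coefficient, which
  is then eliminated from the others. Needed for the exchange property of rows and for the affine
  dependency of \<open>d + 2\<close> points.\<close>

lemma homogeneous_solution:
  fixes M :: "'i \<Rightarrow> 'j \<Rightarrow> real"
  assumes "finite J" "finite I" "card J < card I"
  obtains c where "\<exists>i\<in>I. c i \<noteq> 0" "\<And>j. j \<in> J \<Longrightarrow> (\<Sum>i\<in>I. c i * M i j) = 0"
proof -
  have "\<exists>c. (\<exists>i\<in>I. c i \<noteq> 0) \<and> (\<forall>j\<in>J. (\<Sum>i\<in>I. c i * M i j) = 0)"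
    using assms
  proof (induction J arbitrary: I M rule: finite_induct)
    case empty
    then have "I \<noteq> {}" by auto
    then show ?case by (intro exI[of _ "\<lambda>_. 1"]) auto
  next
    case (insert j J)
    show ?case
    proof (cases "\<forall>i\<in>I. M i j = 0")
      case True
      have "card J < card I" using insert by simp
      then obtain c where c: "\<exists>i\<in>I. c i \<noteq> 0" "\<forall>j\<in>J. (\<Sum>i\<in>I. c i * M i j) = 0"
        using insert.IH[OF insert.prems(1)] by blast
      then show ?thesis using True by (intro exI[of _ c]) auto
    next
      case False
      then obtain i0 where i0: "i0 \<in> I" "M i0 j \<noteq> 0" by auto
      let ?I = "I - {i0}"
      have "finite ?I" "card J < card ?I" using insert i0 by auto
      then obtain c where c: "\<exists>i\<in>?I. c i \<noteq> 0"
        "\<forall>l\<in>J. (\<Sum>i\<in>?I. c i * (M i l - M i j / M i0 j * M i0 l)) = 0"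
        using insert.IH[of ?I "\<lambda>i l. M i l - M i j / M i0 j * M i0 l"] by blast
      define c' where "c' = c(i0 := - (\<Sum>i\<in>?I. c i * M i j) / M i0 j)"
      have "(\<Sum>i\<in>I. c' i * M i l) = (\<Sum>i\<in>?I. c i * (M i l - M i j / M i0 j * M i0 l))" for l
      proof -
        have "(\<Sum>i\<in>I. c' i * M i l) = c' i0 * M i0 l + (\<Sum>i\<in>?I. c' i * M i l)"
          using i0 insert.prems(1) by (intro sum.remove)
        also have "(\<Sum>i\<in>?I. c' i * M i l) = (\<Sum>i\<in>?I. c i * M i l)"
          by (intro sum.cong) (auto simp: c'_def)
        also have "c' i0 * M i0 l = - (\<Sum>i\<in>?I. c i * (M i j / M i0 j * M i0 l))"
          by (simp add: c'_def sum_distrib_right sum_divide_distrib sum_negf[symmetric] mult.assoc)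
        finally show ?thesis by (simp add: right_diff_distrib sum_subtractf)
      qed
      then have "\<forall>l\<in>insert j J. (\<Sum>i\<in>I. c' i * M i l) = 0" using c i0 by simp
      moreover have "\<exists>i\<in>I. c' i \<noteq> 0" using c by (auto simp: c'_def)
      ultimately show ?thesis by blast
    qed
  qed
  then show ?thesis using that by blast
qed

text \<open>Stated for arbitrary matrices, because elimination and both extensions involve auxiliary
  matrices other than the rigidity matrix.\<close>

definition rows_indep :: "('e \<Rightarrow> 'c \<Rightarrow> real) \<Rightarrow> 'e set \<Rightarrow> bool" where
  "rows_indep M F \<longleftrightarrow> (\<forall>c. (\<forall>col. (\<Sum>e\<in>F. c e * M e col) = 0) \<longrightarrow> (\<forall>e\<in>F. c e = 0))"

lemma rows_lin_indep_eq: "rows_lin_indep d p F = rows_indep (rig_row d p) F"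
  by (simp add: rows_lin_indep_def rows_indep_def)

lemma rows_indepD:
  "rows_indep M F \<Longrightarrow> (\<And>col. (\<Sum>e\<in>F. c e * M e col) = 0) \<Longrightarrow> e \<in> F \<Longrightarrow> c e = 0"
  by (auto simp: rows_indep_def)

lemma rows_indep_subset:
  assumes "finite F" "rows_indep M F" "F' \<subseteq> F"
  shows "rows_indep M F'"
  unfolding rows_indep_def
proof (intro allI impI)
  fix c assume c: "\<forall>col. (\<Sum>e\<in>F'. c e * M e col) = 0"
  let ?c = "\<lambda>e. if e \<in> F' then c e else 0"
  have "(\<Sum>e\<in>F. ?c e * M e col) = (\<Sum>e\<in>F'. c e * M e col)" for col
    using assms by (intro sum.mono_neutral_cong_right) auto
  then have "?c e = 0" if "e \<in> F" for e using c that rows_indepD[OF assms(2), where c = ?c] by auto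
  then show "\<forall>e\<in>F'. c e = 0" using assms(3) by (meson subsetD)
qed

text \<open>If no row of \<open>J\<close> can be added, all of them are combinations of the rows in
  \<open>I\<close>. Their coefficient vectors have fewer entries than there are rows in
  \<open>J\<close>, so a relation exists.\<close>

lemma rows_indep_augment:
  assumes fin: "finite I" "finite J" and ind: "rows_indep M I" "rows_indep M J" and card: "card I < card J"
  shows "\<exists>e\<in>J - I. rows_indep M (insert e I)"
proof (rule ccontr)
  assume no: "\<not> ?thesis"
  have "\<exists>a. \<forall>col. M e col = (\<Sum>f\<in>I. a f * M f col)" if e: "e \<in> J" for e
  proof (cases "e \<in> I")
    case True
    then show ?thesis using fin
      by (intro exI[of _ "\<lambda>f. if f = e then 1 else 0"]) (auto simp: if_distrib[of "\<lambda>x. x * _"] cong: if_cong)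
  next
    case False
    then obtain c where c: "\<And>col. (\<Sum>f\<in>insert e I. c f * M f col) = 0" "\<exists>f\<in>insert e I. c f \<noteq> 0"
      using no e unfolding rows_indep_def by blast
    have sum: "c e * M e col + (\<Sum>f\<in>I. c f * M f col) = 0" for col using c(1)[of col] False fin by simp
    have "c e \<noteq> 0"
    proof
      assume "c e = 0"
      then have "\<forall>f\<in>I. c f = 0" using ind(1) sum unfolding rows_indep_def by simp
      then show False using c(2) \<open>c e = 0\<close> by auto
    qed
    then have "M e col = (\<Sum>f\<in>I. (- c f / c e) * M f col)" for col
      using sum[of col] by (simp add: sum_divide_distrib[symmetric] sum_negf field_simps)
    then show ?thesis by (intro exI[of _ "\<lambda>f. - c f / c e"]) simp
  qed
  then obtain a where a: "\<And>e col. e \<in> J \<Longrightarrow> M e col = (\<Sum>f\<in>I. a e f * M f col)" by metis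
  obtain c where c: "\<exists>e\<in>J. c e \<noteq> 0" "\<And>f. f \<in> I \<Longrightarrow> (\<Sum>e\<in>J. c e * a e f) = 0"
    using homogeneous_solution[OF fin card] by metis
  have "(\<Sum>e\<in>J. c e * M e col) = 0" for col
  proof -
    have "(\<Sum>e\<in>J. c e * M e col) = (\<Sum>e\<in>J. \<Sum>f\<in>I. c e * a e f * M f col)"
      by (intro sum.cong refl) (simp add: a sum_distrib_left mult.assoc)
    also have "\<dots> = (\<Sum>f\<in>I. (\<Sum>e\<in>J. c e * a e f) * M f col)"
      by (subst sum.swap) (simp add: sum_distrib_right)
    finally show ?thesis using c(2) by simp
  qed
  then show False using ind(2) c(1) unfolding rows_indep_def by blast
qed

text \<open>Polynomial functions with rational coefficients. Multiplication only by a variable makes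
  the translation to formal polynomials a mere shift of monomials; general products are
  derived.\<close>

inductive ratpoly :: "'v set \<Rightarrow> (('v \<Rightarrow> real) \<Rightarrow> real) \<Rightarrow> bool" for I where
  ratpoly_const: "q \<in> \<rat> \<Longrightarrow> ratpoly I (\<lambda>f. q)"
| ratpoly_add: "ratpoly I g \<Longrightarrow> ratpoly I h \<Longrightarrow> ratpoly I (\<lambda>f. g f + h f)"
| ratpoly_var_mult: "x \<in> I \<Longrightarrow> ratpoly I g \<Longrightarrow> ratpoly I (\<lambda>f. f x * g f)"

lemma ratpoly_const_mult: "ratpoly I g \<Longrightarrow> q \<in> \<rat> \<Longrightarrow> ratpoly I (\<lambda>f. q * g f)"
proof (induction rule: ratpoly.induct)
  case (ratpoly_const r)
  then show ?case by (intro ratpoly.ratpoly_const) auto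
next
  case (ratpoly_add g h)
  then show ?case using ratpoly.ratpoly_add[of I "\<lambda>f. q * g f" "\<lambda>f. q * h f"] by (simp add: distrib_left)
next
  case (ratpoly_var_mult x g)
  then show ?case using ratpoly.ratpoly_var_mult[of x I "\<lambda>f. q * g f"] by (simp add: mult.left_commute)
qed

lemma ratpoly_mult: "ratpoly I g \<Longrightarrow> ratpoly I h \<Longrightarrow> ratpoly I (\<lambda>f. g f * h f)"
proof (induction rule: ratpoly.induct)
  case (ratpoly_const r)
  then show ?case by (intro ratpoly_const_mult)
next
  case (ratpoly_add g g')
  then show ?case using ratpoly.ratpoly_add[of I "\<lambda>f. g f * h f" "\<lambda>f. g' f * h f"] by (simp add: distrib_right)
next
  case (ratpoly_var_mult x g)
  then show ?case using ratpoly.ratpoly_var_mult[of x I "\<lambda>f. g f * h f"] by (simp add: mult.assoc)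
qed

lemma ratpoly_var: "x \<in> I \<Longrightarrow> ratpoly I (\<lambda>f. f x)"
  using ratpoly_var_mult[of x I "\<lambda>_. 1"] ratpoly_const[of 1 I] by simp

lemma ratpoly_diff: "ratpoly I g \<Longrightarrow> ratpoly I h \<Longrightarrow> ratpoly I (\<lambda>f. g f - h f)"
  using ratpoly_add[of I g "\<lambda>f. (-1) * h f"] ratpoly_const_mult[of I h "-1"] by simp

lemma ratpoly_sum:
  "finite A \<Longrightarrow> (\<And>a. a \<in> A \<Longrightarrow> ratpoly I (g a)) \<Longrightarrow> ratpoly I (\<lambda>f. \<Sum>a\<in>A. g a f)"
proof (induction A rule: finite_induct)
  case empty
  then show ?case using ratpoly_const[of 0 I] by simp
next
  case (insert a A)
  then show ?case using ratpoly_add[of I "g a"] by simp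
qed

section \<open>Evaluation of formal polynomials and existence of generic points\<close>

definition monomial :: "('v \<Rightarrow>\<^sub>0 nat) \<Rightarrow> ('v \<Rightarrow> real) \<Rightarrow> real" where
  "monomial m f = (\<Prod>x\<in>Poly_Mapping.keys m. f x ^ Poly_Mapping.lookup m x)"

lemma monomial_superset:
  "finite S \<Longrightarrow> Poly_Mapping.keys m \<subseteq> S \<Longrightarrow> monomial m f = (\<Prod>x\<in>S. f x ^ Poly_Mapping.lookup m x)"
  unfolding monomial_def by (intro prod.mono_neutral_left) (auto simp: in_keys_iff)

lemma monomial_add: "monomial (m + m') f = monomial m f * monomial m' f"
proof -
  let ?S = "Poly_Mapping.keys m \<union> Poly_Mapping.keys m'"
  have "monomial (m + m') f = (\<Prod>x\<in>?S. f x ^ Poly_Mapping.lookup (m + m') x)"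
    by (intro monomial_superset keys_add) simp
  also have "\<dots> = (\<Prod>x\<in>?S. f x ^ Poly_Mapping.lookup m x) * (\<Prod>x\<in>?S. f x ^ Poly_Mapping.lookup m' x)"
    by (simp add: lookup_add power_add prod.distrib)
  also have "\<dots> = monomial m f * monomial m' f"
    using monomial_superset[of ?S m f] monomial_superset[of ?S m' f] by simp
  finally show ?thesis .
qed

lemma mpoly_eval_superset:
  "finite S \<Longrightarrow> Poly_Mapping.keys P \<subseteq> S \<Longrightarrow>
    mpoly_eval P f = (\<Sum>m\<in>S. Poly_Mapping.lookup P m * monomial m f)"
  unfolding mpoly_eval_def monomial_def by (intro sum.mono_neutral_left) (auto simp: in_keys_iff)

lemma mpoly_eval_add: "mpoly_eval (P + Q) f = mpoly_eval P f + mpoly_eval Q f"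
proof -
  let ?S = "Poly_Mapping.keys P \<union> Poly_Mapping.keys Q"
  have "mpoly_eval (P + Q) f = (\<Sum>m\<in>?S. Poly_Mapping.lookup (P + Q) m * monomial m f)"
    by (intro mpoly_eval_superset keys_add) simp
  also have "\<dots> = mpoly_eval P f + mpoly_eval Q f"
    using mpoly_eval_superset[of ?S P f] mpoly_eval_superset[of ?S Q f]
    by (simp add: lookup_add distrib_right sum.distrib)
  finally show ?thesis .
qed

lemma mpoly_eval_0: "mpoly_eval 0 f = 0"
  by (simp add: mpoly_eval_def)

lemma mpoly_eval_single: "mpoly_eval (Poly_Mapping.single m c) f = c * monomial m f"
  using mpoly_eval_superset[of "{m}" "Poly_Mapping.single m c" f] by simp

lemma mpoly_eval_sum:
  "finite A \<Longrightarrow> mpoly_eval (\<Sum>a\<in>A. P a) f = (\<Sum>a\<in>A. mpoly_eval (P a) f)"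
  by (induction A rule: finite_induct) (auto simp: mpoly_eval_0 mpoly_eval_add)

definition rational_mpoly :: "'v set \<Rightarrow> (('v \<Rightarrow>\<^sub>0 nat) \<Rightarrow>\<^sub>0 real) \<Rightarrow> bool" where
  "rational_mpoly I P \<longleftrightarrow> (\<forall>m. Poly_Mapping.lookup P m \<in> \<rat>) \<and>
     (\<forall>m\<in>Poly_Mapping.keys P. Poly_Mapping.keys m \<subseteq> I)"

lemma alg_indep_Q_iff:
  "alg_indep_Q I f \<longleftrightarrow> (\<forall>P. rational_mpoly I P \<and> mpoly_eval P f = 0 \<longrightarrow> P = 0)"
  by (auto simp: alg_indep_Q_def rational_mpoly_def)

lemma rational_mpoly_single:
  "c \<in> \<rat> \<Longrightarrow> Poly_Mapping.keys m \<subseteq> I \<Longrightarrow> rational_mpoly I (Poly_Mapping.single m c)"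
  by (auto simp: rational_mpoly_def lookup_single when_def split: if_splits)

lemma rational_mpoly_add: "rational_mpoly I P \<Longrightarrow> rational_mpoly I Q \<Longrightarrow> rational_mpoly I (P + Q)"
  by (auto simp: rational_mpoly_def lookup_add dest!: subsetD[OF keys_add[of P Q]])

lemma rational_mpoly_sum:
  "finite A \<Longrightarrow> (\<And>a. a \<in> A \<Longrightarrow> rational_mpoly I (P a)) \<Longrightarrow> rational_mpoly I (\<Sum>a\<in>A. P a)"
  by (induction A rule: finite_induct) (auto simp: rational_mpoly_add, simp add: rational_mpoly_def)

lemma ratpoly_mpoly_eval:
  assumes "ratpoly I g"
  shows "\<exists>P. rational_mpoly I P \<and> g = mpoly_eval P"
  using assms
proof (induction rule: ratpoly.induct)
  case (ratpoly_const q)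
  then show ?case
    by (intro exI[of _ "Poly_Mapping.single 0 q"])
       (auto simp: rational_mpoly_single mpoly_eval_single monomial_def)
next
  case (ratpoly_add g h)
  then obtain P Q where "rational_mpoly I P" "g = mpoly_eval P" "rational_mpoly I Q" "h = mpoly_eval Q"
    by blast
  then show ?case by (intro exI[of _ "P + Q"]) (auto simp: rational_mpoly_add mpoly_eval_add)
next
  case (ratpoly_var_mult x g)
  then obtain P where P: "rational_mpoly I P" "g = mpoly_eval P" by blast
  let ?X = "Poly_Mapping.single x (Suc 0)"
  let ?Q = "\<Sum>m\<in>Poly_Mapping.keys P. Poly_Mapping.single (?X + m) (Poly_Mapping.lookup P m)"
  have "rational_mpoly I ?Q"
  proof (intro rational_mpoly_sum rational_mpoly_single)
    fix m assume m: "m \<in> Poly_Mapping.keys P"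
    then show "Poly_Mapping.lookup P m \<in> \<rat>" using P by (simp add: rational_mpoly_def)
    show "Poly_Mapping.keys (?X + m) \<subseteq> I"
      using keys_add[of ?X m] m P ratpoly_var_mult(1) by (auto simp: rational_mpoly_def)
  qed simp
  moreover have "f x * g f = mpoly_eval ?Q f" for f
  proof -
    have X: "monomial ?X f = f x" by (simp add: monomial_def)
    have "mpoly_eval ?Q f = (\<Sum>m\<in>Poly_Mapping.keys P. Poly_Mapping.lookup P m * (f x * monomial m f))"
      by (simp add: mpoly_eval_sum mpoly_eval_single monomial_add X)
    also have "\<dots> = f x * mpoly_eval P f"
      using mpoly_eval_superset[of "Poly_Mapping.keys P" P f]
      by (simp add: sum_distrib_left mult.left_commute)
    finally show ?thesis using P by simp
  qed
  ultimately show ?case by blast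
qed

text \<open>The transfer principle: a rational polynomial function vanishing at a generic point
  vanishes everywhere, so one special point with nonzero value settles all generic points.\<close>

lemma ratpoly_alg_indep:
  assumes "alg_indep_Q I f" "ratpoly I g" "g f = 0"
  shows "g f0 = 0"
proof -
  obtain P where P: "rational_mpoly I P" "g = mpoly_eval P" using ratpoly_mpoly_eval[OF assms(2)] by blast
  then have "P = 0" using assms by (auto simp: alg_indep_Q_iff)
  then show ?thesis using P by (simp add: mpoly_eval_0)
qed

lemma countable_rational_mpoly:
  assumes "finite I"
  shows "countable {P. rational_mpoly I P}"
proof -
  obtain xs where xs: "set xs = I" using assms finite_list by blast
  have "inj_on (\<lambda>m. map (Poly_Mapping.lookup m) xs) {m :: 'a \<Rightarrow>\<^sub>0 nat. Poly_Mapping.keys m \<subseteq> I}"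
  proof (rule inj_onI, rule poly_mapping_eqI)
    fix m m' :: "'a \<Rightarrow>\<^sub>0 nat" and x
    assume m: "m \<in> {m. Poly_Mapping.keys m \<subseteq> I}" "m' \<in> {m. Poly_Mapping.keys m \<subseteq> I}"
      and eq: "map (Poly_Mapping.lookup m) xs = map (Poly_Mapping.lookup m') xs"
    show "Poly_Mapping.lookup m x = Poly_Mapping.lookup m' x"
    proof (cases "x \<in> I")
      case True
      then show ?thesis using eq xs by auto
    next
      case False
      then have "x \<notin> Poly_Mapping.keys m" "x \<notin> Poly_Mapping.keys m'" using m by auto
      then show ?thesis by (simp add: in_keys_iff)
    qed
  qed
  then have "countable {m :: 'a \<Rightarrow>\<^sub>0 nat. Poly_Mapping.keys m \<subseteq> I}"
    by (metis countableI_type countable_image_inj_on)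
  then have "countable ({m :: 'a \<Rightarrow>\<^sub>0 nat. Poly_Mapping.keys m \<subseteq> I} \<times> (\<rat> :: real set))" (is "countable ?A")
    using countable_rat by (rule countable_SIGMA)
  then have "countable {T. finite T \<and> T \<subseteq> ?A}" by (rule countable_Collect_finite_subset)
  moreover let ?g = "\<lambda>P :: ('a \<Rightarrow>\<^sub>0 nat) \<Rightarrow>\<^sub>0 real. (\<lambda>m. (m, Poly_Mapping.lookup P m)) ` Poly_Mapping.keys P"
  have "?g ` {P. rational_mpoly I P} \<subseteq> {T. finite T \<and> T \<subseteq> ?A}"
    by (auto simp: rational_mpoly_def)
  ultimately have "countable (?g ` {P. rational_mpoly I P})" using countable_subset by blast
  moreover have "inj ?g"
  proof (rule injI, rule poly_mapping_eqI)
    fix P Q :: "('a \<Rightarrow>\<^sub>0 nat) \<Rightarrow>\<^sub>0 real" and m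
    assume eq: "?g P = ?g Q"
    have "(m, c) \<in> ?g P \<longleftrightarrow> c = Poly_Mapping.lookup P m \<and> c \<noteq> 0" for P c
      by (auto simp: in_keys_iff)
    then show "Poly_Mapping.lookup P m = Poly_Mapping.lookup Q m" using eq by metis
  qed
  then have "inj_on ?g {P. rational_mpoly I P}" by (rule inj_on_subset) simp
  ultimately show ?thesis by (rule countable_image_inj_on)
qed

lemma monomial_update:
  "monomial m (f(x := t)) = t ^ Poly_Mapping.lookup m x * monomial (Poly_Mapping.update x 0 m) f"
proof -
  let ?S = "insert x (Poly_Mapping.keys m)"
  have "monomial m (f(x := t)) = (\<Prod>y\<in>?S. (f(x := t)) y ^ Poly_Mapping.lookup m y)"
    by (intro monomial_superset) auto
  also have "\<dots> = t ^ Poly_Mapping.lookup m x * (\<Prod>y\<in>?S - {x}. f y ^ Poly_Mapping.lookup m y)"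
    by (subst prod.remove[of _ x]) (auto intro!: prod.cong)
  also have "(\<Prod>y\<in>?S - {x}. f y ^ Poly_Mapping.lookup m y)
      = (\<Prod>y\<in>?S - {x}. f y ^ Poly_Mapping.lookup (Poly_Mapping.update x 0 m) y)"
    by (intro prod.cong) (auto simp: lookup_update)
  also have "\<dots> = monomial (Poly_Mapping.update x 0 m) f"
    by (intro monomial_superset[symmetric]) (auto simp: keys_update)
  finally show ?thesis .
qed

text \<open>Sorting by powers of \<open>x\<close> gives a univariate polynomial in \<open>t\<close>
  whose coefficients are rational polynomials at the independent point \<open>f\<close>. A formally
  nonzero coefficient has nonzero value.\<close>

lemma finite_zeros_of_one_coordinate:
  assumes f: "alg_indep_Q I f" and P: "rational_mpoly (insert x I) P" "P \<noteq> 0"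
  shows "finite {t. mpoly_eval P (f(x := t)) = 0}"
proof -
  let ?K = "Poly_Mapping.keys P" and ?deg = "\<lambda>m. Poly_Mapping.lookup m x"
  let ?r = "Poly_Mapping.update x 0"
  define n where "n = Max (?deg ` ?K)"
  define Q where "Q k = (\<Sum>m\<in>{m\<in>?K. ?deg m = k}. Poly_Mapping.single (?r m) (Poly_Mapping.lookup P m))" for k
  have le: "?deg m \<le> n" if "m \<in> ?K" for m using that by (auto simp: n_def)
  have "mpoly_eval P (f(x := t)) = (\<Sum>k\<le>n. mpoly_eval (Q k) f * t ^ k)" for t
  proof -
    have "mpoly_eval P (f(x := t)) = (\<Sum>m\<in>?K. Poly_Mapping.lookup P m * (t ^ ?deg m * monomial (?r m) f))"
      by (subst mpoly_eval_superset[of ?K]) (auto simp: monomial_update)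
    also have "\<dots> = (\<Sum>k\<le>n. \<Sum>m\<in>{m\<in>?K. ?deg m = k}. Poly_Mapping.lookup P m * (t ^ ?deg m * monomial (?r m) f))"
      using le by (intro sum.group[symmetric]) auto
    also have "\<dots> = (\<Sum>k\<le>n. mpoly_eval (Q k) f * t ^ k)"
      by (intro sum.cong refl)
         (auto simp: Q_def mpoly_eval_sum mpoly_eval_single sum_distrib_right intro!: sum.cong)
    finally show ?thesis .
  qed
  moreover have "\<exists>k\<le>n. mpoly_eval (Q k) f \<noteq> 0"
  proof -
    obtain m0 where m0: "m0 \<in> ?K" using P(2) by (metis all_not_in_conv keys_eq_empty)
    let ?k = "?deg m0"
    \<comment> \<open>Monomials of equal degree in \<open>x\<close> stay distinct once
      \<open>x\<close> is removed, so nothing cancels in \<open>Q\<close>.\<close>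
    have inj: "m = m0" if "?deg m = ?k" "?r m = ?r m0" for m
    proof (rule poly_mapping_eqI)
      fix y
      show "Poly_Mapping.lookup m y = Poly_Mapping.lookup m0 y"
        using that(1) arg_cong[OF that(2), of "\<lambda>m. Poly_Mapping.lookup m y"] by (cases "y = x") (auto simp: lookup_update)
    qed
    have "Poly_Mapping.lookup (Q ?k) (?r m0)
      = (\<Sum>m\<in>{m\<in>?K. ?deg m = ?k}. if m = m0 then Poly_Mapping.lookup P m0 else 0)"
      unfolding Q_def lookup_sum by (intro sum.cong) (auto simp: lookup_single when_def dest: inj)
    then have "Poly_Mapping.lookup (Q ?k) (?r m0) = Poly_Mapping.lookup P m0" using m0 by simp
    then have "Q ?k \<noteq> 0" using m0 by (auto simp: in_keys_iff)
    moreover have "rational_mpoly I (Q ?k)"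
      unfolding Q_def using P(1)
      by (intro rational_mpoly_sum rational_mpoly_single) (auto simp: rational_mpoly_def keys_update)
    ultimately have "mpoly_eval (Q ?k) f \<noteq> 0" using f by (auto simp: alg_indep_Q_iff)
    then show ?thesis using le m0 by blast
  qed
  ultimately show ?thesis
    using polyfun_finite_roots[of "\<lambda>k. mpoly_eval (Q k) f" n] by simp
qed

text \<open>Coordinates are chosen one at a time: countably many polynomials exclude finitely many
  reals each.\<close>

lemma alg_indep_Q_exists:
  assumes "finite I"
  shows "\<exists>f. alg_indep_Q I f"
  using assms
proof (induction I rule: finite_induct)
  case empty
  have "P = 0" if P: "rational_mpoly {} P" "mpoly_eval P f = 0" for P :: "('a \<Rightarrow>\<^sub>0 nat) \<Rightarrow>\<^sub>0 real" and f
  proof -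
    have "Poly_Mapping.keys P \<subseteq> {0}" using P(1) by (auto simp: rational_mpoly_def)
    then have "mpoly_eval P f = Poly_Mapping.lookup P 0 * monomial 0 f"
      by (subst mpoly_eval_superset[of "{0}"]) auto
    then have "Poly_Mapping.lookup P 0 = 0" using P(2) by (simp add: monomial_def)
    then have "0 \<notin> Poly_Mapping.keys P" by (simp add: in_keys_iff)
    then show "P = 0" using \<open>Poly_Mapping.keys P \<subseteq> {0}\<close> by (metis keys_eq_empty subset_singletonD singletonI)
  qed
  then show ?case by (auto simp: alg_indep_Q_iff)
next
  case (insert x I)
  then obtain f where f: "alg_indep_Q I f" by blast
  let ?T = "\<Union>P\<in>{P. rational_mpoly (insert x I) P} - {0}. {t. mpoly_eval P (f(x := t)) = 0}"
  have "countable ?T"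
    using finite_zeros_of_one_coordinate[OF f] countable_rational_mpoly[of "insert x I"] insert.hyps(1)
    by (intro countable_UN countable_Diff) (auto intro: countable_finite)
  then obtain t where "t \<notin> ?T" using uncountable_UNIV_real by (metis UNIV_eq_I)
  then have "alg_indep_Q (insert x I) (f(x := t))" by (auto simp: alg_indep_Q_iff)
  then show ?case by blast
qed

text \<open>Fraction-free Gaussian elimination: the certificate \<open>D\<close> is a product of pivots, hence a
  polynomial in the entries.\<close>

lemma rows_indep_certificate:
  fixes M :: "('v \<Rightarrow> real) \<Rightarrow> 'e \<Rightarrow> 'c \<Rightarrow> real"
  assumes "finite F" "\<And>e col. e \<in> F \<Longrightarrow> ratpoly I (\<lambda>f. M f e col)" "rows_indep (M f0) F"
  shows "\<exists>D. ratpoly I D \<and> D f0 \<noteq> 0 \<and> (\<forall>f. D f \<noteq> 0 \<longrightarrow> rows_indep (M f) F)"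
  using assms
proof (induction F arbitrary: M rule: finite_induct)
  case empty
  then show ?case by (intro exI[of _ "\<lambda>_. 1"]) (auto simp: rows_indep_def ratpoly_const)
next
  case (insert e F)
  note poly = insert.prems(1) and ind = insert.prems(2)
  have "\<exists>k. M f0 e k \<noteq> 0"
  proof (rule ccontr)
    assume "\<not> ?thesis"
    then have "\<forall>col. (\<Sum>f\<in>insert e F. (if f = e then 1 else 0) * M f0 f col) = 0"
      by (auto intro!: sum.neutral)
    then show False using ind unfolding rows_indep_def by force
  qed
  then obtain k where k: "M f0 e k \<noteq> 0" by blast
  \<comment> \<open>Clears column \<open>k\<close> with pivot row \<open>e\<close>, multiplying by
    the pivot instead of dividing, so that entries remain polynomial.\<close>
  define M' where "M' f a col = M f e k * M f a col - M f a k * M f e col" for f a col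
  have combine: "(\<Sum>a\<in>F. c a * M' f a col)
    = M f e k * (\<Sum>a\<in>F. c a * M f a col) - (\<Sum>a\<in>F. c a * M f a k) * M f e col" for c f col
    by (simp add: M'_def sum_subtractf sum_distrib_left sum_distrib_right algebra_simps)
  have "rows_indep (M' f0) F"
    unfolding rows_indep_def
  proof (intro allI impI)
    fix c assume c: "\<forall>col. (\<Sum>a\<in>F. c a * M' f0 a col) = 0"
    let ?c = "\<lambda>a. if a = e then - (\<Sum>a\<in>F. c a * M f0 a k) else M f0 e k * c a"
    have "(\<Sum>a\<in>insert e F. ?c a * M f0 a col) = 0" for col
    proof -
      have "(\<Sum>a\<in>F. ?c a * M f0 a col) = M f0 e k * (\<Sum>a\<in>F. c a * M f0 a col)"
        unfolding sum_distrib_left using insert.hyps by (intro sum.cong) auto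
      then show ?thesis using c combine[of c f0 col] insert.hyps by simp
    qed
    then have "?c a = 0" if "a \<in> insert e F" for a using that by (rule rows_indepD[OF ind, where c = ?c])
    then show "\<forall>a\<in>F. c a = 0" using k insert.hyps
      by (metis insertI2 mult_eq_0_iff)
  qed
  moreover have "ratpoly I (\<lambda>f. M' f a col)" if "a \<in> F" for a col
    unfolding M'_def using poly that by (intro ratpoly_diff ratpoly_mult) auto
  ultimately obtain D where D: "ratpoly I D" "D f0 \<noteq> 0" "\<And>f. D f \<noteq> 0 \<Longrightarrow> rows_indep (M' f) F"
    using insert.IH[of M'] by blast
  have "rows_indep (M f) (insert e F)" if nz: "M f e k \<noteq> 0" "D f \<noteq> 0" for f
    unfolding rows_indep_def
  proof (intro allI impI)
    fix c assume "\<forall>col. (\<Sum>a\<in>insert e F. c a * M f a col) = 0"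
    then have c: "(\<Sum>a\<in>F. c a * M f a col) = - c e * M f e col" for col
      using insert.hyps by (auto simp: eq_neg_iff_add_eq_0 add.commute)
    have "(\<Sum>a\<in>F. c a * M' f a col) = 0" for col
      unfolding combine c by (simp add: algebra_simps)
    then have F: "\<forall>a\<in>F. c a = 0" using D(3)[OF nz(2)] unfolding rows_indep_def by blast
    then have "c e = 0" using c[of k] nz by simp
    then show "\<forall>a\<in>insert e F. c a = 0" using F by simp
  qed
  moreover have "ratpoly I (\<lambda>f. M f e k * D f)" using poly D by (intro ratpoly_mult) auto
  ultimately show ?case using k D by (intro exI[of _ "\<lambda>f. M f e k * D f"]) auto
qed

lemma rows_indep_generic:
  assumes "alg_indep_Q I f" "finite F" "\<And>e col. e \<in> F \<Longrightarrow> ratpoly I (\<lambda>f. M f e col)" "rows_indep (M f0) F"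
  shows "rows_indep (M f) F"
proof -
  obtain D where "ratpoly I D" "D f0 \<noteq> 0" "\<forall>f. D f \<noteq> 0 \<longrightarrow> rows_indep (M f) F"
    using rows_indep_certificate[of F I M f0] assms(2-4) by blast
  then show ?thesis using ratpoly_alg_indep[OF assms(1)] by blast
qed

section \<open>The generic rigidity matroid\<close>

lemma rig_row_outside: "w \<notin> e \<Longrightarrow> rig_row d p e (w, i) = 0"
  by (simp add: rig_row_def)

lemma rig_row_ge_dim: "\<not> i < d \<Longrightarrow> rig_row d p e (w, i) = 0"
  by (simp add: rig_row_def)

lemma rig_row_pair:
  "u \<noteq> v \<Longrightarrow> i < d \<Longrightarrow> rig_row d p {u, v} (w, i)
    = (if w = u then p u i - p v i else if w = v then p v i - p u i else 0)"
  by (simp add: rig_row_def)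

definition coords :: "('a \<times> nat \<Rightarrow> real) \<Rightarrow> 'a \<Rightarrow> nat \<Rightarrow> real" where
  "coords f v i = f (v, i)"

lemma coords_case_prod: "coords (\<lambda>(v, i). p v i) = p"
  by (simp add: coords_def fun_eq_iff)

lemma generic_exists: "finite V \<Longrightarrow> \<exists>p. generic d V p"
  using alg_indep_Q_exists[of "V \<times> {0..<d}"] unfolding generic_def
  by (metis (mono_tags, lifting) case_prod_eta curry_def case_prod_curry finite_SigmaI finite_atLeastLessThan)

lemma generic_rows_indep:
  assumes p: "generic d V p" and F: "finite F"
    and poly: "\<And>e col. e \<in> F \<Longrightarrow> ratpoly (V \<times> {0..<d}) (\<lambda>f. M (coords f) e col)"
    and q: "rows_indep (M q) F"
  shows "rows_indep (M p) F"
proof -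
  have "rows_indep (M (coords (\<lambda>(v, i). q v i))) F" using q by (simp add: coords_case_prod)
  then have "rows_indep (M (coords (\<lambda>(v, i). p v i))) F"
    using rows_indep_generic[of "V \<times> {0..<d}" "\<lambda>(v, i). p v i" F "\<lambda>f. M (coords f)" "\<lambda>(v, i). q v i"]
      p F poly unfolding generic_def by blast
  then show ?thesis by (simp add: coords_case_prod)
qed

lemma ratpoly_coord: "v \<in> V \<Longrightarrow> i < d \<Longrightarrow> ratpoly (V \<times> {0..<d}) (\<lambda>f. coords f v i)"
  unfolding coords_def by (rule ratpoly_var) simp

text \<open>Independence at any configuration, however special, carries over to every generic one.
  Hence the matroid does not depend on the generic point chosen.\<close>

lemma generic_rows_lin_indep:
  assumes "generic d V p" "is_graph F" "verts F \<subseteq> V" "rows_lin_indep d q F"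
  shows "rows_lin_indep d p F"
  unfolding rows_lin_indep_eq
proof (rule generic_rows_indep[OF assms(1)])
  show "finite F" using assms(2) by (simp add: is_graph_def)
  show "rows_indep (rig_row d q) F" using assms(4) by (simp add: rows_lin_indep_eq)
  fix e and col :: "'a \<times> nat"
  assume e: "e \<in> F"
  then have e': "finite e" "e \<subseteq> V"
    using assms(2,3) by (auto simp: is_graph_def verts_def intro: card_ge_0_finite)
  show "ratpoly (V \<times> {0..<d}) (\<lambda>f. rig_row d (coords f) e col)"
  proof (cases "fst col \<in> e \<and> snd col < d")
    case True
    then have "ratpoly (V \<times> {0..<d}) (\<lambda>f. \<Sum>x\<in>e. coords f (fst col) (snd col) - coords f x (snd col))"
      using e' by (intro ratpoly_sum ratpoly_diff ratpoly_coord) auto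
    then show ?thesis using True by (simp add: rig_row_def case_prod_beta)
  next
    case False
    then have "(\<lambda>f. rig_row d (coords f) e col) = (\<lambda>_. 0)" by (auto simp: rig_row_def case_prod_beta)
    then show ?thesis using ratpoly_const[of 0] by simp
  qed
qed

text \<open>Independent of any ambient graph, and with an arbitrary configuration, so that special
  placements may serve as witnesses. \<open>is_graph\<close> discards infinite sets and sets that
  are not edges.\<close>

definition rind :: "nat \<Rightarrow> 'a set set \<Rightarrow> bool" where
  "rind d F \<longleftrightarrow> is_graph F \<and> (\<exists>p. rows_lin_indep d p F)"

lemma rind_generic:
  "generic d V p \<Longrightarrow> verts F \<subseteq> V \<Longrightarrow> rind d F \<longleftrightarrow> is_graph F \<and> rows_lin_indep d p F"
  unfolding rind_def using generic_rows_lin_indep by blast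

lemma rig_indep_iff_rind:
  assumes "is_graph E"
  shows "rig_indep d E F \<longleftrightarrow> F \<subseteq> E \<and> rind d F"
proof -
  obtain p where p: "generic d (verts E) p" using generic_exists finite_verts assms by blast
  have "rind d F \<longleftrightarrow> (\<exists>p. generic d (verts E) p \<and> rows_lin_indep d p F)" if "F \<subseteq> E"
  proof -
    have "is_graph F" "verts F \<subseteq> verts E" using that assms is_graph_mono by (auto simp: verts_def)
    then show ?thesis using p rind_generic by blast
  qed
  then show ?thesis by (auto simp: rig_indep_def)
qed

lemma is_graph_Un_star:
  "is_graph F \<Longrightarrow> finite N \<Longrightarrow> v \<notin> N \<Longrightarrow> is_graph (F \<union> star v N)"
  by (auto simp: is_graph_def star_def card_2_iff)

lemma star_dependency:
  assumes F: "finite F" "v \<notin> verts F" and N: "finite N" "v \<notin> N"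
    and c: "\<forall>col. (\<Sum>e\<in>F \<union> star v N. c e * rig_row d p e col) = 0"
  shows "i < d \<Longrightarrow> (\<Sum>u\<in>N. c {v, u} * (p v i - p u i)) = 0"
    and "(\<Sum>e\<in>F. c e * rig_row d p e col) + (\<Sum>u\<in>N. c {v, u} * rig_row d p {v, u} col) = 0"
proof -
  have disj: "F \<inter> star v N = {}" using F by (auto simp: star_def verts_def)
  show split: "(\<Sum>e\<in>F. c e * rig_row d p e col) + (\<Sum>u\<in>N. c {v, u} * rig_row d p {v, u} col) = 0" for col
  proof -
    have "(\<Sum>e\<in>F \<union> star v N. c e * rig_row d p e col)
      = (\<Sum>e\<in>F. c e * rig_row d p e col) + (\<Sum>e\<in>star v N. c e * rig_row d p e col)"
      using F N disj by (intro sum.union_disjoint) auto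
    also have "(\<Sum>e\<in>star v N. c e * rig_row d p e col) = (\<Sum>u\<in>N. c {v, u} * rig_row d p {v, u} col)"
      unfolding star_def by (subst sum.reindex) (auto simp: inj_on_def doubleton_eq_iff)
    finally show ?thesis using c by simp
  qed
  assume i: "i < d"
  have "(\<Sum>e\<in>F. c e * rig_row d p e (v, i)) = 0"
    using F(2) by (intro sum.neutral) (auto simp: verts_def rig_row_outside)
  moreover have "(\<Sum>u\<in>N. c {v, u} * rig_row d p {v, u} (v, i)) = (\<Sum>u\<in>N. c {v, u} * (p v i - p u i))"
  proof (rule sum.cong[OF refl])
    fix u assume "u \<in> N"
    then have "v \<noteq> u" using N by auto
    then show "c {v, u} * rig_row d p {v, u} (v, i) = c {v, u} * (p v i - p u i)"
      using i by (simp add: rig_row_pair)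
  qed
  ultimately show "(\<Sum>u\<in>N. c {v, u} * (p v i - p u i)) = 0" using split[of "(v, i)"] by simp
qed

text \<open>The columns of \<open>v\<close> see only the star, so it is enough that the vectors from
  \<open>v\<close> to \<open>N\<close> are independent at a generic point; by transfer a single
  configuration \<open>q\<close> with this property suffices.\<close>

lemma rind_zero_extension:
  assumes F: "rind d F" "v \<notin> verts F" and N: "finite N" "v \<notin> N" "card N \<le> d"
  shows "rind d (F \<union> star v N)"
proof -
  have gF: "is_graph F" using F by (simp add: rind_def)
  then have finF: "finite F" by (simp add: is_graph_def)
  let ?V = "verts F \<union> insert v N"
  have "finite ?V" using gF N finite_verts by auto
  then obtain p where p: "generic d ?V p" using generic_exists by blast
  have indF: "rows_lin_indep d p F" using rind_generic[OF p] F by auto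
  define M where "M p u i = (if i < d then p v i - p u i else 0 :: real)" for p :: "'a \<Rightarrow> nat \<Rightarrow> real" and u i
  obtain g where g: "inj_on g N" "g ` N \<subseteq> {..<d}"
    using N by (metis card_le_inj card_lessThan finite_lessThan)
  define q where "q w i = (if w \<in> N \<and> i = g w then 1 else 0 :: real)" for w i
  have "rows_indep (M q) N"
    unfolding rows_indep_def
  proof (intro allI impI ballI)
    fix c u assume c: "\<forall>col. (\<Sum>e\<in>N. c e * M q e col) = 0" and u: "u \<in> N"
    have "(\<Sum>e\<in>N. c e * M q e (g u)) = (\<Sum>e\<in>N. if e = u then - c u else 0)"
      using g u N by (intro sum.cong) (auto simp: M_def q_def inj_on_def)
    then show "c u = 0" using c u N by simp
  qed
  moreover have "ratpoly (?V \<times> {0..<d}) (\<lambda>f. M (coords f) u i)" if "u \<in> N" for u i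
    unfolding M_def using that ratpoly_const[of 0]
    by (cases "i < d") (auto intro!: ratpoly_diff ratpoly_coord)
  ultimately have indM: "rows_indep (M p) N" using generic_rows_indep[OF p N(1), where M = M] by blast
  have "rows_lin_indep d p (F \<union> star v N)"
    unfolding rows_lin_indep_def
  proof (intro allI impI)
    fix c assume c: "\<forall>col. (\<Sum>e\<in>F \<union> star v N. c e * rig_row d p e col) = 0"
    note dep = star_dependency[OF finF F(2) N(1,2) c]
    have "(\<Sum>u\<in>N. c {v, u} * M p u i) = 0" for i
      using dep(1)[of i] by (cases "i < d") (auto simp: M_def)
    then have 0: "c {v, u} = 0" if "u \<in> N" for u
      using that by (rule rows_indepD[OF indM, where c = "\<lambda>u. c {v, u}"])
    then have "(\<Sum>e\<in>F. c e * rig_row d p e col) = 0" for col using dep(2)[of col] by simp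
    then have "\<forall>e\<in>F. c e = 0" using indF unfolding rows_lin_indep_def by blast
    then show "\<forall>e\<in>F \<union> star v N. c e = 0" using 0 by (auto simp: star_def)
  qed
  then show ?thesis using is_graph_Un_star[OF gF N(1,2)] by (auto simp: rind_def)
qed

text \<open>Place \<open>v\<close> at the midpoint of \<open>x\<close> and \<open>y\<close>, all other vertices generically: the rows of
  \<open>vx\<close> and \<open>vy\<close> then add up to half the row of \<open>xy\<close>.\<close>

lemma rind_one_extension:
  assumes F: "rind d (insert {x, y} F)" "{x, y} \<notin> F" "v \<notin> verts (insert {x, y} F)"
    and N: "x \<in> N" "y \<in> N" "v \<notin> N" "card N = d + 1"
  shows "rind d (F \<union> star v N)"
proof -
  have gF: "is_graph (insert {x, y} F)" using F by (simp add: rind_def)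
  then have gF': "is_graph F" using is_graph_mono by blast
  then have finF: "finite F" by (simp add: is_graph_def)
  have xy: "x \<noteq> y" using gF by (auto simp: is_graph_def)
  have finN: "finite N" using N by (metis Suc_eq_plus1 card.infinite nat.simps(3))
  have vF: "v \<notin> verts F" and vxy: "v \<noteq> x" "v \<noteq> y" using F(3) by (auto simp: verts_def)
  let ?V = "verts (insert {x, y} F) \<union> N"
  have "finite ?V" using gF finN finite_verts by auto
  then obtain p where p: "generic d ?V p" using generic_exists by blast
  have indF: "rows_lin_indep d p (insert {x, y} F)" using rind_generic[OF p] F by auto
  let ?N = "N - {y}"
  \<comment> \<open>The columns of \<open>v\<close> with \<open>v\<close> at the midpoint: the edges
    to \<open>x\<close> and \<open>y\<close> both point along \<open>p x - p y\<close>, so they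
    share the row indexed by \<open>x\<close>, and \<open>d\<close> rows remain.\<close>
  define M where "M p u i = (if i < d then if u = x then p x i - p y i else (p x i + p y i) / 2 - p u i else 0 :: real)"
    for p :: "'a \<Rightarrow> nat \<Rightarrow> real" and u i
  have "card ?N \<le> card {..<d}" using N finN by simp
  then obtain g where g: "inj_on g ?N" "g ` ?N \<subseteq> {..<d}"
    using finN by (metis card_le_inj finite_Diff finite_lessThan)
  \<comment> \<open>Here \<open>x\<close> and \<open>y\<close> are opposite unit vectors, so the
    midpoint is the origin, and the remaining neighbours lie along the other axes.\<close>
  define q where "q w i = (if w \<in> ?N \<and> i = g w then 1 else if w = y \<and> i = g x then -1 else 0 :: real)" for w i
  have "rows_indep (M q) ?N"
    unfolding rows_indep_def
  proof (intro allI impI ballI)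
    fix c u assume c: "\<forall>col. (\<Sum>e\<in>?N. c e * M q e col) = 0" and u: "u \<in> ?N"
    have "(\<Sum>e\<in>?N. c e * M q e (g u)) = (\<Sum>e\<in>?N. if e = u then (if u = x then 2 * c u else - c u) else 0)"
    proof (rule sum.cong[OF refl])
      fix e assume e: "e \<in> ?N"
      have "g e = g u \<longleftrightarrow> e = u" "g x = g u \<longleftrightarrow> x = u" "g u < d" using g e u N xy by (auto simp: inj_on_def)
      then show "c e * M q e (g u) = (if e = u then (if u = x then 2 * c u else - c u) else 0)"
        using e u N xy by (auto simp: M_def q_def)
    qed
    then have "(if u = x then 2 * c u else - c u) = 0" using c u finN by (simp del: mult_eq_0_iff)
    then show "c u = 0" by (auto split: if_splits)
  qed
  moreover have "ratpoly (?V \<times> {0..<d}) (\<lambda>f. M (coords f) u i)" if u: "u \<in> ?N" for u i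
  proof (cases "i < d")
    case True
    have 1: "ratpoly (?V \<times> {0..<d}) (\<lambda>f. coords f x i - coords f y i)"
      using True N by (intro ratpoly_diff ratpoly_coord) auto
    have 2: "ratpoly (?V \<times> {0..<d}) (\<lambda>f. 1 / 2 * (coords f x i + coords f y i) - coords f u i)"
      using True N u by (intro ratpoly_diff ratpoly_coord ratpoly_const_mult ratpoly_add) auto
    show ?thesis using True 1 2 by (cases "u = x") (auto simp: M_def)
  next
    case False
    then show ?thesis using ratpoly_const[of 0] by (simp add: M_def)
  qed
  ultimately have indM: "rows_indep (M p) ?N" using generic_rows_indep[OF p finite_Diff[OF finN], where M = M] by blast
  define r where "r = p(v := \<lambda>i. (p x i + p y i) / 2)"
  have rp: "rig_row d r e = rig_row d p e" if "e \<in> F" for e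
  proof -
    have "v \<notin> e" using that vF by (auto simp: verts_def)
    then show ?thesis by (auto simp: rig_row_def r_def intro!: ext sum.cong)
  qed
  have "rows_lin_indep d r (F \<union> star v N)"
    unfolding rows_lin_indep_def
  proof (intro allI impI)
    fix c assume c: "\<forall>col. (\<Sum>e\<in>F \<union> star v N. c e * rig_row d r e col) = 0"
    note dep = star_dependency[OF finF vF finN N(3) c]
    have split: "(\<Sum>u\<in>N. h u) = h y + (h x + (\<Sum>u\<in>?N - {x}. h u))" for h :: "'a \<Rightarrow> real"
      using N finN xy by (subst sum.remove[of N y]; simp; subst sum.remove[of ?N x]; simp)
    \<comment> \<open>The net coefficient of \<open>p x - p y\<close> contributed by the edges
      \<open>vx\<close> and \<open>vy\<close>.\<close>
    let ?c = "\<lambda>u. if u = x then (c {v, y} - c {v, x}) / 2 else c {v, u}"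
    have "(\<Sum>u\<in>?N. ?c u * M p u i) = 0" for i
    proof (cases "i < d")
      case True
      have "(\<Sum>u\<in>?N. ?c u * M p u i) = ?c x * M p x i + (\<Sum>u\<in>?N - {x}. ?c u * M p u i)"
        using finN N xy by (intro sum.remove) auto
      also have "(\<Sum>u\<in>?N - {x}. ?c u * M p u i) = (\<Sum>u\<in>?N - {x}. c {v, u} * (r v i - r u i))"
        using True N by (intro sum.cong) (auto simp: M_def r_def)
      also have "?c x * M p x i = c {v, y} * (r v i - r y i) + c {v, x} * (r v i - r x i)"
        using True vxy by (simp add: M_def r_def field_simps)
      finally show ?thesis using dep(1)[OF True] split[of "\<lambda>u. c {v, u} * (r v i - r u i)"] by simp
    qed (simp add: M_def)
    then have 0: "?c u = 0" if "u \<in> ?N" for u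
      using that by (rule rows_indepD[OF indM, where c = ?c])
    have cy: "c {v, y} = c {v, x}" using 0[of x] N xy by simp
    have cu: "c {v, u} = 0" if "u \<in> N" "u \<noteq> x" "u \<noteq> y" for u using 0[of u] that by simp
    \<comment> \<open>With equal coefficients on \<open>vx\<close> and \<open>vy\<close>, the
      dependency becomes one of \<open>insert {x, y} F\<close>; the factor 1/2 comes from the
      midpoint.\<close>
    let ?b = "\<lambda>e. if e = {x, y} then c {v, x} / 2 else c e"
    have "(\<Sum>e\<in>insert {x, y} F. ?b e * rig_row d p e (w, i)) = 0" for w i
    proof -
      have "(\<Sum>e\<in>insert {x, y} F. ?b e * rig_row d p e (w, i))
        = c {v, x} / 2 * rig_row d p {x, y} (w, i) + (\<Sum>e\<in>F. ?b e * rig_row d p e (w, i))"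
        using finF F(2) by simp
      also have "(\<Sum>e\<in>F. ?b e * rig_row d p e (w, i)) = (\<Sum>e\<in>F. c e * rig_row d r e (w, i))"
        using F(2) rp by (intro sum.cong) auto
      also have "\<dots> = - (\<Sum>u\<in>N. c {v, u} * rig_row d r {v, u} (w, i))"
        using dep(2)[of "(w, i)"] by simp
      also have "(\<Sum>u\<in>N. c {v, u} * rig_row d r {v, u} (w, i))
        = c {v, x} * (rig_row d r {v, x} (w, i) + rig_row d r {v, y} (w, i))"
        using split[of "\<lambda>u. c {v, u} * rig_row d r {v, u} (w, i)"] cu cy by (simp add: distrib_left)
      also have "rig_row d r {v, x} (w, i) + rig_row d r {v, y} (w, i) = rig_row d p {x, y} (w, i) / 2"
        using vxy xy by (cases "i < d") (auto simp: rig_row_pair rig_row_ge_dim r_def field_simps)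
      finally show ?thesis by simp
    qed
    then have "(\<Sum>e\<in>insert {x, y} F. ?b e * rig_row d p e col) = 0" for col by (cases col) blast
    then have b: "?b e = 0" if "e \<in> insert {x, y} F" for e
      using that by (rule rows_indepD[OF indF[unfolded rows_lin_indep_eq], where c = ?b])
    have "c {v, x} = 0" using b[of "{x, y}"] by simp
    moreover have "\<forall>e\<in>F. c e = 0" using b F(2) by (metis insertI2)
    ultimately show "\<forall>e\<in>F \<union> star v N. c e = 0" using cy cu by (auto simp: star_def)
  qed
  then show ?thesis using is_graph_Un_star[OF gF' finN N(3)] by (auto simp: rind_def)
qed

text \<open>An affine dependency \<open>\<lambda>\<close> of \<open>d + 2\<close> points gives the stress \<open>\<lambda>\<^sub>u * \<lambda>\<^sub>w\<close> on the edges \<open>uw\<close>.\<close>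

lemma clique_not_rind:
  assumes W: "card W = d + 2"
  shows "\<not> rind d (all_edges W)"
proof
  assume "rind d (all_edges W)"
  then obtain p where ind: "rows_lin_indep d p (all_edges W)" by (auto simp: rind_def)
  have finW: "finite W" using W by (metis card.infinite add_2_eq_Suc' nat.simps(3))
  \<comment> \<open>The \<open>d\<close> coordinates and the constant 1 give \<open>d + 1\<close>
    equations in \<open>d + 2\<close> unknowns.\<close>
  obtain l where nz: "\<exists>w\<in>W. l w \<noteq> 0"
    and sol: "\<And>j. j \<in> {..d} \<Longrightarrow> (\<Sum>w\<in>W. l w * (if j < d then p w j else 1)) = 0"
    using homogeneous_solution[of "{..d}" W "\<lambda>w j. if j < d then p w j else 1"] finW W by auto
  have s1: "(\<Sum>w\<in>W. l w) = 0" using sol[of d] by simp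
  have s2: "(\<Sum>w\<in>W. l w * p w i) = 0" if "i < d" for i using sol[of i] that by simp
  have "(\<Sum>e\<in>all_edges W. (\<Prod>x\<in>e. l x) * rig_row d p e (w, i)) = 0" for w i
  proof (cases "w \<in> W \<and> i < d")
    case False
    then have "rig_row d p e (w, i) = 0" if "e \<in> all_edges W" for e
      using that by (auto simp: all_edges_def rig_row_def)
    then show ?thesis by simp
  next
    case True
    let ?U = "W - {w}"
    have eq: "all_edges W = all_edges ?U \<union> star w ?U"
      using True all_edges_insert[of w ?U] by (simp add: insert_absorb)
    have "(\<Sum>e\<in>all_edges W. (\<Prod>x\<in>e. l x) * rig_row d p e (w, i))
      = (\<Sum>e\<in>star w ?U. (\<Prod>x\<in>e. l x) * rig_row d p e (w, i))"
      unfolding eq using finW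
      by (intro sum.mono_neutral_right) (auto simp: all_edges_def rig_row_def)
    also have "\<dots> = (\<Sum>u\<in>?U. l w * l u * (p w i - p u i))"
    proof -
      have "(\<Prod>x\<in>{w, u}. l x) * rig_row d p {w, u} (w, i) = l w * l u * (p w i - p u i)"
        if "u \<in> ?U" for u
      proof -
        have "w \<noteq> u" using that by auto
        then show ?thesis using True by (simp add: rig_row_pair)
      qed
      then show ?thesis
        unfolding star_def by (subst sum.reindex) (auto simp: inj_on_def doubleton_eq_iff)
    qed
    also have "\<dots> = (\<Sum>u\<in>W. l w * l u * (p w i - p u i))"
      using finW True by (intro sum.mono_neutral_left) auto
    also have "\<dots> = l w * (p w i * (\<Sum>u\<in>W. l u) - (\<Sum>u\<in>W. l u * p u i))"
      by (simp add: sum_distrib_left sum_distrib_right right_diff_distrib sum_subtractf mult_ac)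
    finally show ?thesis using s1 s2 True by simp
  qed
  then have "\<forall>col. (\<Sum>e\<in>all_edges W. (\<Prod>x\<in>e. l x) * rig_row d p e col) = 0" by auto
  then have zero: "(\<Prod>x\<in>e. l x) = 0" if "e \<in> all_edges W" for e
    using ind that unfolding rows_lin_indep_def by blast
  \<comment> \<open>Vanishing of all products leaves at most one nonzero \<open>l a\<close>,
    contradicting the zero sum.\<close>
  obtain a where a: "a \<in> W" "l a \<noteq> 0" using nz by blast
  have "l b = 0" if "b \<in> W" "b \<noteq> a" for b using zero[of "{a, b}"] that a by auto
  then have "(\<Sum>w\<in>W. l w) = l a" using a finW by (subst sum.remove[of W a]) auto
  then show False using s1 a by simp
qed

lemma rigidity_matroid_rind:
  assumes "d \<ge> 1"
  shows "rigidity_matroid (rind d :: 'a set set \<Rightarrow> bool) d"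
proof unfold_locales
  fix I J F :: "'a set set" and v x y :: 'a and N W :: "'a set"
  show "finite I" if "rind d I" using that by (simp add: rind_def is_graph_def)
  show "rind d ({} :: 'a set set)" by (auto simp: rind_def is_graph_def rows_lin_indep_def)
  show "rind d J" if "rind d I" "J \<subseteq> I"
    using that rows_indep_subset is_graph_mono unfolding rind_def rows_lin_indep_eq is_graph_def by metis
  show "\<exists>e\<in>J - I. rind d (insert e I)" if IJ: "rind d I" "rind d J" "card I < card J"
  proof -
    have gr: "is_graph I" "is_graph J" using IJ by (auto simp: rind_def)
    \<comment> \<open>One configuration that is generic for both graphs turns the exchange into
      linear algebra of a single matrix.\<close>
    then obtain p where p: "generic d (verts I \<union> verts J) p"
      using generic_exists[of "verts I \<union> verts J"] finite_verts by blast
    have "rows_lin_indep d p I" "rows_lin_indep d p J"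
      using rind_generic[OF p, of I] rind_generic[OF p, of J] IJ by auto
    then obtain e where e: "e \<in> J - I" "rows_lin_indep d p (insert e I)"
      using rows_indep_augment[of I J] gr IJ(3) unfolding rows_lin_indep_eq is_graph_def by metis
    moreover have "is_graph (insert e I)" using e gr by (auto simp: is_graph_def)
    ultimately show ?thesis by (auto simp: rind_def)
  qed
  show "1 \<le> d" by fact
  show "rind d (F \<union> star v N)" if "rind d F" "v \<notin> verts F" "finite N" "v \<notin> N" "card N \<le> d"
    using that by (rule rind_zero_extension)
  show "rind d (F \<union> star v N)"
    if "rind d (insert {x, y} F)" "{x, y} \<notin> F" "v \<notin> verts (insert {x, y} F)"
      "x \<in> N" "y \<in> N" "v \<notin> N" "card N = d + 1"
    using that by (rule rind_one_extension)
  show "\<not> rind d (all_edges W)" if "card W = d + 2" using that by (rule clique_not_rind)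
qed

section \<open>Reconstruction\<close>

lemma rig_rank_eq_rk:
  assumes "d \<ge> 1" "is_graph E" "F \<subseteq> E"
  shows "rig_rank d E F = finitary_matroid.rk (rind d) F"
proof -
  interpret rigidity_matroid "rind d :: 'a set set \<Rightarrow> bool" d using assms(1) by (rule rigidity_matroid_rind)
  have "I \<subseteq> F \<and> rig_indep d E I \<longleftrightarrow> I \<subseteq> F \<and> rind d I" for I
    using assms(3) rig_indep_iff_rind[OF assms(2)] by blast
  then show ?thesis by (simp add: rig_rank_def rk_def)
qed

lemma vert_k_connected_imp_vconn:
  assumes d: "d \<ge> 1" and E: "is_graph E" "vert_k_connected d E K"
  shows "rigidity_matroid.vconn (rind d) K E"
proof -
  interpret rigidity_matroid "rind d :: 'a set set \<Rightarrow> bool" d using d by (rule rigidity_matroid_rind)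
  note rank = rig_rank_eq_rk[OF d E(1)]
  show ?thesis
    unfolding vconn_def
  proof (intro conjI allI impI)
    show "K \<le> rk E" using E(2) rank[of E] by (simp add: vert_k_connected_def)
    fix E1 E2 assume E12: "E1 \<union> E2 = E" "E1 \<inter> E2 = {}"
    then have ranks: "rig_rank d E E1 = rk E1" "rig_rank d E E2 = rk E2" "rig_rank d E E = rk E"
      using rank by auto
    \<comment> \<open>The largest order below \<open>K\<close> at which the pair could be a
      separation; for order 0 subadditivity suffices.\<close>
    let ?k = "min (min (rk E1) (rk E2)) (K - 1)"
    show "rk E + ?k \<le> rk E1 + rk E2"
    proof (cases "?k = 0")
      case True
      have "finite E1" "finite E2" using E12 E(1) by (auto simp: is_graph_def)
      then show ?thesis using rk_Un_le[of E1 E2] E12 True by simp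
    next
      case False
      then have "0 < ?k \<and> ?k < K" by linarith
      then have "\<not> vertical_sep d E ?k E1 E2" using E(2) unfolding vert_k_connected_def by blast
      then have "\<not> rk E1 + rk E2 \<le> rk E + ?k - 1"
        using E12 by (auto simp: vertical_sep_def ranks)
      then show ?thesis using False by linarith
    qed
  qed
qed

locale rigidity_matroid_iso =
  A: rigidity_matroid indA d + B: rigidity_matroid indB d
  for indA :: "'a set set \<Rightarrow> bool" and indB :: "'b set set \<Rightarrow> bool" and d +
  fixes G :: "'a set set" and H :: "'b set set" and \<psi> :: "'a set \<Rightarrow> 'b set"
  assumes graphs: "is_graph G" "is_graph H"
    and bij: "bij_betw \<psi> G H"
    and indep_iff: "F \<subseteq> G \<Longrightarrow> indA F \<longleftrightarrow> indB (\<psi> ` F)"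
begin

lemma rk_image:
  assumes "F \<subseteq> G"
  shows "B.rk (\<psi> ` F) = A.rk F"
proof -
  have inj: "inj_on \<psi> I" if "I \<subseteq> F" for I
    using bij assms that by (meson bij_betw_imp_inj_on inj_on_subset)
  have "{card J | J. J \<subseteq> \<psi> ` F \<and> indB J} = {card I | I. I \<subseteq> F \<and> indA I}"
  proof safe
    fix J assume J: "J \<subseteq> \<psi> ` F" "indB J"
    then obtain I where I: "I \<subseteq> F" "J = \<psi> ` I" by (meson subset_imageE)
    then show "\<exists>I. card J = card I \<and> I \<subseteq> F \<and> indA I"
      using J assms indep_iff card_image[OF inj] by (intro exI[of _ I]) auto
  next
    fix I assume I: "I \<subseteq> F" "indA I"
    then show "\<exists>J. card I = card J \<and> J \<subseteq> \<psi> ` F \<and> indB J"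
      using assms indep_iff card_image[OF inj] by (intro exI[of _ "\<psi> ` I"]) auto
  qed
  then show ?thesis by (simp add: A.rk_def B.rk_def)
qed

lemma vconn_image:
  assumes "F \<subseteq> G" "A.vconn K F"
  shows "B.vconn K (\<psi> ` F)"
  unfolding B.vconn_def
proof (intro conjI allI impI)
  show "K \<le> B.rk (\<psi> ` F)" using assms rk_image by (simp add: A.vconn_def)
  fix E1 E2 assume E: "E1 \<union> E2 = \<psi> ` F" "E1 \<inter> E2 = {}"
  let ?D1 = "{e \<in> F. \<psi> e \<in> E1}" and ?D2 = "{e \<in> F. \<psi> e \<in> E2}"
  have "E1 \<subseteq> \<psi> ` F" "E2 \<subseteq> \<psi> ` F" using E(1) by auto
  then have "\<psi> ` ?D1 = E1" "\<psi> ` ?D2 = E2" by blast+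
  moreover have "?D1 \<subseteq> G" "?D2 \<subseteq> G" using assms by auto
  ultimately have "B.rk E1 = A.rk ?D1" "B.rk E2 = A.rk ?D2" using rk_image by metis+
  moreover have "?D1 \<union> ?D2 = F" "?D1 \<inter> ?D2 = {}" using E by auto
  then have "A.rk F + min (min (A.rk ?D1) (A.rk ?D2)) (K - 1) \<le> A.rk ?D1 + A.rk ?D2"
    using assms(2) unfolding A.vconn_def by blast
  ultimately show "B.rk (\<psi> ` F) + min (min (B.rk E1) (B.rk E2)) (K - 1) \<le> B.rk E1 + B.rk E2"
    using rk_image[OF assms(1)] by simp
qed

text \<open>The matroid of a highly connected subgraph of \<open>G\<close> is so highly connected that its image in
  \<open>H\<close> is \<open>d (d + 1)\<close>-connected, hence rigid; the rank then determines the number of vertices.\<close>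

lemma card_verts_image:
  assumes F: "F \<subseteq> G" "k_connected m F" and m: "d * (d + 1)\<^sup>2 \<le> m + 1"
  shows "card (verts (\<psi> ` F)) = card (verts F)"
proof -
  let ?X = "d * (d + 1)"
  \<comment> \<open>Large enough to make the image \<open>?X\<close>-connected, and
    \<open>?X + ?K - 1\<close> is exactly the connectivity that survives the deletion of one vertex
    from \<open>G\<close>.\<close>
  let ?K = "d * ?X"
  have d: "1 \<le> d" by (rule A.d_pos)
  have X: "2 \<le> ?X" using d mult_le_mono[of 1 d 2 "d + 1"] by simp
  have XK: "?X \<le> ?K" "1 \<le> ?K" using d X mult_le_mono1[of 1 d ?X] by auto
  have "d * (d + 1)\<^sup>2 = ?X + ?K" by (simp add: power2_eq_square algebra_simps)
  then have mK: "?X + (?K - 1) \<le> m" using m XK by linarith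
  have grF: "is_graph F" "is_graph (\<psi> ` F)"
    using graphs F(1) is_graph_mono bij by (metis, metis bij_betw_imp_surj_on image_mono)
  have "A.vconn ?K F" using A.k_connected_imp_vconn[OF grF(1) F(2) mK] .
  then have v: "B.vconn ?K (\<psi> ` F)" by (rule vconn_image[OF F(1)])
  have "d * (?X - 2) + 2 \<le> ?K"
  proof -
    have "d * (?X - 2) + d * 2 = ?K" using X by (metis add_mult_distrib2 le_add_diff_inverse2)
    then show ?thesis using d by linarith
  qed
  then have con: "k_connected ?X (\<psi> ` F)" using B.vconn_imp_k_connected[OF grF(2) v] XK by blast
  have conF: "k_connected ?X F" using mK by (intro k_connected_mono[OF F(2)]) linarith
  have "rho d (card (verts (\<psi> ` F))) = rho d (card (verts F))"
    using A.connected_imp_rigid[OF grF(1) conF] B.connected_imp_rigid[OF grF(2) con] rk_image[OF F(1)]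
    by simp
  moreover have "1 \<le> card (verts (\<psi> ` F))" "1 \<le> card (verts F)"
    using con conF by (auto simp: k_connected_def)
  ultimately show ?thesis using rho_strict_mono[OF d] by (metis less_irrefl linorder_neqE_nat)
qed

text \<open>The image of \<open>G - v\<close> has one vertex less than \<open>H\<close>, so it
  misses a single \<open>w\<close>. It already has the full rank of a graph on the remaining
  vertices, whereas any edge at \<open>v\<close> raises the rank; hence images of edges at
  \<open>v\<close> contain \<open>w\<close>.\<close>

lemma vertex_deleted_image:
  assumes c: "k_connected (d * (d + 1)\<^sup>2) G" and v: "v \<in> verts G"
  shows "\<exists>w\<in>verts H. \<psi> ` del_vertex v G = del_vertex w H"
proof -
  let ?F = "del_vertex v G"
  have inj: "inj_on \<psi> G" and im: "\<psi> ` G = H" using bij by (auto simp: bij_betw_def)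
  have FG: "?F \<subseteq> G" by (rule del_vertex_subset)
  have "2 \<le> d * (d + 1)\<^sup>2"
    using A.d_pos mult_le_mono[of 1 d 2 "(d + 1)\<^sup>2"] by (simp add: power2_eq_square)
  then obtain m where m: "d * (d + 1)\<^sup>2 = Suc m" "1 \<le> m" by (cases "d * (d + 1)\<^sup>2") auto
  have del: "verts ?F = verts G - {v}" "k_connected m ?F"
    using k_connected_del_vertex[OF graphs(1) _ v m(2)] c m(1) by simp_all
  have finV: "finite (verts G)" "finite (verts H)" using graphs finite_verts by auto
  have "card (verts H) = card (verts G)" using card_verts_image[OF order_refl c] im by simp
  moreover have "card (verts (\<psi> ` ?F)) = card (verts G - {v})"
    using card_verts_image[OF FG del(2)] m(1) del(1) by simp
  moreover have sub: "verts (\<psi> ` ?F) \<subseteq> verts H" using im FG by (auto simp: verts_def)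
  ultimately have "card (verts H - verts (\<psi> ` ?F)) = 1"
    using card.remove[OF finV(1) v] finite_subset[OF sub finV(2)] by (simp add: card_Diff_subset)
  then obtain w where w: "verts H - verts (\<psi> ` ?F) = {w}" by (meson card_1_singletonE)
  then have wH: "w \<in> verts H" and vF: "verts (\<psi> ` ?F) = verts H - {w}" using sub by auto
  have "\<psi> ` ?F = del_vertex w H"
  proof
    show "\<psi> ` ?F \<subseteq> del_vertex w H" using im FG vF by (auto simp: del_vertex_def verts_def)
    show "del_vertex w H \<subseteq> \<psi> ` ?F"
    proof (rule subsetI, rule ccontr)
      fix e assume e: "e \<in> del_vertex w H" "e \<notin> \<psi> ` ?F"
      then obtain e0 where e0: "e0 \<in> G" "e = \<psi> e0" using im by (auto simp: del_vertex_def)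
      then have "v \<in> e0" using e by (auto simp: del_vertex_def)
      then have "e0 \<in> star v (nbrs G v)" using star_nbrs[OF graphs(1)] e0 by auto
      then obtain u where u: "e0 = {v, u}" "u \<in> nbrs G v" by (auto simp: star_def)
      have grF: "is_graph ?F" using is_graph_mono[OF graphs(1) FG] .
      have "A.rk ?F + min (card {u}) d \<le> A.rk (?F \<union> star v {u})"
        using grF u(2) not_in_nbrs[OF graphs(1), of v] not_in_verts_del_vertex[of v G]
        by (intro A.rk_add_star) (auto simp: is_graph_def)
      then have "A.rk ?F < A.rk (insert e0 ?F)" using A.d_pos u(1) by (simp add: star_def)
      moreover have "B.rk (\<psi> ` insert e0 ?F) = A.rk (insert e0 ?F)" using e0 FG by (intro rk_image) auto
      moreover have "B.rk (\<psi> ` insert e0 ?F) \<le> rho d (card (verts H - {w}))"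
      proof (rule B.rk_le_rho)
        have "\<psi> ` insert e0 ?F \<subseteq> H" using im FG e0 by auto
        moreover have "verts (\<psi> ` insert e0 ?F) \<subseteq> verts H - {w}"
          using vF e(1) e0(2) by (auto simp: verts_def del_vertex_def)
        ultimately show "\<psi> ` insert e0 ?F \<subseteq> all_edges (verts H - {w})"
          using graphs(2) by (auto simp: all_edges_def verts_def is_graph_def)
      qed (use finV in simp)
      moreover have "rho d (card (verts H - {w})) = A.rk ?F"
      proof -
        have "d * (d + 1) \<le> m"
        proof -
          have "d * (d + 1) + d * (d * (d + 1)) = Suc m" unfolding m(1)[symmetric]
            by (simp add: power2_eq_square algebra_simps)
          moreover have "1 \<le> d * (d * (d + 1))" using A.d_pos by simp
          ultimately show ?thesis by linarith
        qed
        then have "k_connected (d * (d + 1)) ?F" using k_connected_mono[OF del(2)] by blast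
        then show ?thesis
          using A.connected_imp_rigid[OF grF] card_verts_image[OF FG del(2)] m(1) vF by simp
      qed
      ultimately show False by linarith
    qed
  qed
  then show ?thesis using wH by blast
qed

text \<open>Let \<open>\<phi> v\<close> be the vertex missed by the image of \<open>G - v\<close>.
  Membership of an edge in \<open>G - v\<close> is then equivalent to its image avoiding
  \<open>\<phi> v\<close>, so incidences are preserved; an edge at \<open>u\<close> that avoids
  \<open>v\<close> distinguishes \<open>\<phi> u\<close> from \<open>\<phi> v\<close>.\<close>

theorem graph_iso:
  assumes c: "k_connected (d * (d + 1)\<^sup>2) G"
  shows "\<exists>\<phi>. bij_betw \<phi> (verts G) (verts H) \<and> (\<forall>e\<in>G. \<psi> e = \<phi> ` e)"
proof -
  have inj: "inj_on \<psi> G" and im: "\<psi> ` G = H" using bij by (auto simp: bij_betw_def)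
  obtain \<phi> where \<phi>: "\<And>v. v \<in> verts G \<Longrightarrow> \<phi> v \<in> verts H \<and> \<psi> ` del_vertex v G = del_vertex (\<phi> v) H"
    using vertex_deleted_image[OF c] by metis
  have inc: "v \<in> e \<longleftrightarrow> \<phi> v \<in> \<psi> e" if "v \<in> verts G" "e \<in> G" for v e
  proof -
    have "v \<notin> e \<longleftrightarrow> e \<in> del_vertex v G" using that by (simp add: del_vertex_def)
    also have "\<dots> \<longleftrightarrow> \<psi> e \<in> \<psi> ` del_vertex v G"
      using inj_on_image_mem_iff[OF inj that(2) del_vertex_subset] by blast
    also have "\<dots> \<longleftrightarrow> \<phi> v \<notin> \<psi> e" using \<phi>[OF that(1)] that(2) im by (auto simp: del_vertex_def)
    finally show ?thesis by blast
  qed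
  have injphi: "inj_on \<phi> (verts G)"
  proof (rule inj_onI)
    fix u v assume uv: "u \<in> verts G" "v \<in> verts G" "\<phi> u = \<phi> v"
    have "d * (d + 1)\<^sup>2 \<le> card (nbrs G u)" using k_connected_min_degree[OF graphs(1) c uv(1)] .
    moreover have "2 \<le> d * (d + 1)\<^sup>2"
      using A.d_pos mult_le_mono[of 1 d 2 "(d + 1)\<^sup>2"] by (simp add: power2_eq_square)
    ultimately have "\<not> nbrs G u \<subseteq> {v}" using card_mono[of "{v}" "nbrs G u"] by auto
    then obtain w where w: "{u, w} \<in> G" "w \<noteq> v" by (auto simp: nbrs_def)
    then have "v \<in> {u, w}" using inc[OF uv(1) w(1)] inc[OF uv(2) w(1)] uv(3) by auto
    then show "u = v" using w by auto
  qed
  have "card (verts H) = card (verts G)" using card_verts_image[OF order_refl c] im by simp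
  moreover have "\<phi> ` verts G \<subseteq> verts H" using \<phi> by auto
  ultimately have "\<phi> ` verts G = verts H"
    using card_image[OF injphi] finite_verts[OF graphs(2)] by (intro card_subset_eq) auto
  then have "bij_betw \<phi> (verts G) (verts H)" using injphi by (simp add: bij_betw_def)
  moreover have "\<psi> e = \<phi> ` e" if e: "e \<in> G" for e
  proof -
    have eV: "e \<subseteq> verts G" using e by (auto simp: verts_def)
    have "\<psi> e \<in> H" using e im by auto
    then have c2: "card (\<psi> e) = 2" using graphs by (simp add: is_graph_def)
    have "card (\<phi> ` e) = 2"
      using card_image[OF inj_on_subset[OF injphi eV]] graphs e by (simp add: is_graph_def)
    moreover have "\<phi> ` e \<subseteq> \<psi> e" using inc e eV by blast
    moreover have "finite (\<psi> e)" using c2 by (metis card.infinite zero_neq_numeral)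
    ultimately show ?thesis using c2 card_subset_eq by metis
  qed
  ultimately show ?thesis by blast
qed

end

theorem theorem3p11:
  fixes d :: nat and G :: "'a set set"
  assumes "d \<ge> 1" and "is_graph G"
    and "k_connected (d * (d + 1)^2) G \<or> vert_k_connected d G ((d * (d + 1))^2)"
  shows "rd_reconstructible d G TYPE('b)"
  unfolding rd_reconstructible_def
proof (intro allI impI)
  fix H :: "'b set set" and \<psi>
  assume H: "is_graph H \<and> rig_matroid_iso d G H \<psi>"
  interpret A: rigidity_matroid "rind d :: 'a set set \<Rightarrow> bool" d
    using assms(1) by (rule rigidity_matroid_rind)
  interpret B: rigidity_matroid "rind d :: 'b set set \<Rightarrow> bool" d
    using assms(1) by (rule rigidity_matroid_rind)
  interpret rigidity_matroid_iso "rind d" "rind d" d G H \<psi>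
  proof unfold_locales
    show "is_graph G" "is_graph H" "bij_betw \<psi> G H"
      using assms(2) H by (auto simp: rig_matroid_iso_def)
    then have "\<psi> ` F \<subseteq> H" if "F \<subseteq> G" for F using that by (auto simp: bij_betw_def)
    then show "rind d F \<longleftrightarrow> rind d (\<psi> ` F)" if "F \<subseteq> G" for F
      using that H rig_indep_iff_rind[OF assms(2)] rig_indep_iff_rind[of H d]
      by (auto simp: rig_matroid_iso_def)
  qed
  have "k_connected (d * (d + 1)\<^sup>2) G"
    using assms(3)
  proof
    assume v: "vert_k_connected d G ((d * (d + 1))\<^sup>2)"
    \<comment> \<open>Vertical connectivity \<open>d * ?c\<close> exceeds the bound
      \<open>d * (?c - 2) + 2\<close> that forces \<open>?c\<close>-connectivity or equals it, which
      leads back to the first hypothesis.\<close>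
    let ?c = "d * (d + 1)\<^sup>2"
    have K: "(d * (d + 1))\<^sup>2 = d * ?c" by (simp add: power2_eq_square algebra_simps)
    have c2: "2 \<le> ?c"
      using assms(1) mult_le_mono[of 1 d 2 "(d + 1)\<^sup>2"] by (simp add: power2_eq_square)
    have "d * (?c - 2) + d * 2 = d * ?c" using c2 by (metis add_mult_distrib2 le_add_diff_inverse2)
    then have "d * (?c - 2) + 2 \<le> (d * (d + 1))\<^sup>2" unfolding K using assms(1) by linarith
    moreover have "?c \<le> (d * (d + 1))\<^sup>2" unfolding K using assms(1) by simp
    ultimately show ?thesis
      using A.vconn_imp_k_connected[OF assms(2) vert_k_connected_imp_vconn[OF assms(1,2) v]] by blast
  qed
  then show "\<exists>\<phi>. bij_betw \<phi> (verts G) (verts H) \<and> (\<forall>e\<in>G. \<psi> e = \<phi> ` e)"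
    by (rule graph_iso)
qed

end
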